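(* Let $\mathbf{C}$ be an entirely inhabited regular category. Then any two copyable states $H,T\colon I\to A$ of a special dagger Frobenius structure $(A,\mu,\eta)$ in $\mathbf{Rel}(\mathbf{C})$ are equal. That is, if $\mu^\dagger\circ H=H\otimes H$ and $\mu^\dagger\circ T=T\otimes T$, then $H=T$.
   Context: A category is regular when it has finite limits, coequalizers of kernel pairs, and regular epimorphisms are stable under pullback. An object $A$ of a regular category is inhabited if the image of $A\to 1$ is all of $1$ (the terminal object); the category is entirely inhabited when every object is inhabited, equivalently when any subobject of a terminal object $1$ is isomorphic to $1$. For $\mathbf{C}$ regular, $\mathbf{Rel}(\mathbf{C})$ has the same objects as $\mathbf{C}$; a morphism $R\colon A\to B$ is a subobject $R\rightarrowtail A\times B$; identities are diagonals; $S\circ R$ is the image of $R\times_B S\to A\times C$, i.e. $\{(a,c)\mid (\exists b)\,R(a,b)\wedge S(b,c)\}$ in the internal regular logic. $\mathbf{Rel}(\mathbf{C})$ is a compact dagger category with $\otimes=\times$, $I=1$, $R^\dagger(b,a)\Leftrightarrow R(a,b)$. A state is a morphism $I\to A$, i.e. a subobject of $A$. A special dagger Frobenius structure in a dagger monoidal category is an object $A$ with $\mu\colon A\otimes A\to A$, $\eta\colon I\to A$ satisfying $\mu(\mathrm{id}\otimes\eta)=\mathrm{id}_A=\mu(\eta\otimes\mathrm{id})$, $\mu(\mu\otimes\mathrm{id})=\mu(\mathrm{id}\otimes\mu)$, $\mu\circ\mu^\dagger=\mathrm{id}_A$, and $(\mu\otimes\mathrm{id})(\mathrm{id}\otimes\mu^\dagger)=(\mathrm{id}\otimes\mu)(\mu^\dagger\otimes\mathrm{id})$.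 *)

theory Defs
  imports Main
begin

section \<open>Categories\<close>

text \<open>\<open>Cmp C g f\<close>, written \<open>g \<cdot>\<^bsub>C\<^esub> f\<close>, is "g after f".\<close>

record ('o, 'a) category =
  Obj :: "'o set"
  Arr :: "'a set"
  Src :: "'a \<Rightarrow> 'o"
  Tgt :: "'a \<Rightarrow> 'o"
  Ident :: "'o \<Rightarrow> 'a"
  Cmp :: "'a \<Rightarrow> 'a \<Rightarrow> 'a"  (infixl "\<cdot>\<index>" 70)

definition hom :: "('o, 'a, 'z) category_scheme \<Rightarrow> 'o \<Rightarrow> 'o \<Rightarrow> 'a set" where
  "hom C A B = {f \<in> Arr C. Src C f = A \<and> Tgt C f = B}"

locale category =
  fixes C :: "('o, 'a, 'z) category_scheme" (structure)
  assumes src_obj: "f \<in> Arr C \<Longrightarrow> Src C f \<in> Obj C"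
    and tgt_obj: "f \<in> Arr C \<Longrightarrow> Tgt C f \<in> Obj C"
    and ident_hom: "A \<in> Obj C \<Longrightarrow> Ident C A \<in> hom C A A"
    and cmp_hom: "f \<in> hom C A B \<Longrightarrow> g \<in> hom C B D \<Longrightarrow> g \<cdot> f \<in> hom C A D"
    and cmp_ident: "f \<in> hom C A B \<Longrightarrow> f \<cdot> Ident C A = f"
    and ident_cmp: "f \<in> hom C A B \<Longrightarrow> Ident C B \<cdot> f = f"
    and cmp_assoc: "f \<in> hom C A B \<Longrightarrow> g \<in> hom C B D \<Longrightarrow> h \<in> hom C D E \<Longrightarrow>
          (h \<cdot> g) \<cdot> f = h \<cdot> (g \<cdot> f)"

section \<open>Finite limits\<close>

definition is_functor ::
  "('i, 'j, 'y) category_scheme \<Rightarrow> ('o, 'a, 'z) category_scheme \<Rightarrow> ('i \<Rightarrow> 'o) \<Rightarrow> ('j \<Rightarrow> 'a) \<Rightarrow> bool" where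
  "is_functor J C F0 F1 \<longleftrightarrow>
     (\<forall>i \<in> Obj J. F0 i \<in> Obj C) \<and>
     (\<forall>u \<in> Arr J. F1 u \<in> hom C (F0 (Src J u)) (F0 (Tgt J u))) \<and>
     (\<forall>i \<in> Obj J. F1 (Ident J i) = Ident C (F0 i)) \<and>
     (\<forall>u \<in> Arr J. \<forall>v \<in> Arr J. Tgt J u = Src J v \<longrightarrow> F1 (v \<cdot>\<^bsub>J\<^esub> u) = F1 v \<cdot>\<^bsub>C\<^esub> F1 u)"

definition is_cone ::
  "('i, 'j, 'y) category_scheme \<Rightarrow> ('o, 'a, 'z) category_scheme \<Rightarrow> ('i \<Rightarrow> 'o) \<Rightarrow> ('j \<Rightarrow> 'a) \<Rightarrow>
   'o \<Rightarrow> ('i \<Rightarrow> 'a) \<Rightarrow> bool" where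
  "is_cone J C F0 F1 X c \<longleftrightarrow>
     X \<in> Obj C \<and> (\<forall>i \<in> Obj J. c i \<in> hom C X (F0 i)) \<and>
     (\<forall>u \<in> Arr J. F1 u \<cdot>\<^bsub>C\<^esub> c (Src J u) = c (Tgt J u))"

definition is_limit ::
  "('i, 'j, 'y) category_scheme \<Rightarrow> ('o, 'a, 'z) category_scheme \<Rightarrow> ('i \<Rightarrow> 'o) \<Rightarrow> ('j \<Rightarrow> 'a) \<Rightarrow>
   'o \<Rightarrow> ('i \<Rightarrow> 'a) \<Rightarrow> bool" where
  "is_limit J C F0 F1 X c \<longleftrightarrow>
     is_cone J C F0 F1 X c \<and>
     (\<forall>Y d. is_cone J C F0 F1 Y d \<longrightarrow>
        (\<exists>!h. h \<in> hom C Y X \<and> (\<forall>i \<in> Obj J. c i \<cdot>\<^bsub>C\<^esub> h = d i)))"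

text \<open>Every finite category is isomorphic to one whose objects and arrows are natural numbers, so
  diagram shapes over \<open>nat\<close> suffice.\<close>

definition has_finite_limits :: "('o, 'a, 'z) category_scheme \<Rightarrow> bool" where
  "has_finite_limits C \<longleftrightarrow>
     (\<forall>(J :: (nat, nat) category) F0 F1.
        category J \<and> finite (Obj J) \<and> finite (Arr J) \<and> is_functor J C F0 F1 \<longrightarrow>
        (\<exists>X c. is_limit J C F0 F1 X c))"

definition is_terminal :: "('o, 'a, 'z) category_scheme \<Rightarrow> 'o \<Rightarrow> bool" where
  "is_terminal C T \<longleftrightarrow> T \<in> Obj C \<and> (\<forall>X \<in> Obj C. \<exists>!u. u \<in> hom C X T)"

definition is_product ::
  "('o, 'a, 'z) category_scheme \<Rightarrow> 'o \<Rightarrow> 'o \<Rightarrow> 'o \<Rightarrow> 'a \<Rightarrow> 'a \<Rightarrow> bool" where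
  "is_product C A B P p q \<longleftrightarrow>
     p \<in> hom C P A \<and> q \<in> hom C P B \<and>
     (\<forall>X f g. f \<in> hom C X A \<and> g \<in> hom C X B \<longrightarrow>
        (\<exists>!h. h \<in> hom C X P \<and> p \<cdot>\<^bsub>C\<^esub> h = f \<and> q \<cdot>\<^bsub>C\<^esub> h = g))"

text \<open>\<open>is_pullback C f g p q\<close>: \<open>(p, q)\<close> is a pullback of the cospan \<open>(f, g)\<close>, with
  \<open>f \<cdot> p = g \<cdot> q\<close>.\<close>

definition is_pullback ::
  "('o, 'a, 'z) category_scheme \<Rightarrow> 'a \<Rightarrow> 'a \<Rightarrow> 'a \<Rightarrow> 'a \<Rightarrow> bool" where
  "is_pullback C f g p q \<longleftrightarrow>
     f \<in> Arr C \<and> g \<in> Arr C \<and> p \<in> Arr C \<and> q \<in> Arr C \<and>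
     Tgt C f = Tgt C g \<and> Src C p = Src C q \<and> Tgt C p = Src C f \<and> Tgt C q = Src C g \<and>
     f \<cdot>\<^bsub>C\<^esub> p = g \<cdot>\<^bsub>C\<^esub> q \<and>
     (\<forall>X x y. x \<in> hom C X (Src C f) \<and> y \<in> hom C X (Src C g) \<and> f \<cdot>\<^bsub>C\<^esub> x = g \<cdot>\<^bsub>C\<^esub> y \<longrightarrow>
        (\<exists>!h. h \<in> hom C X (Src C p) \<and> p \<cdot>\<^bsub>C\<^esub> h = x \<and> q \<cdot>\<^bsub>C\<^esub> h = y))"

section \<open>Regular categories\<close>

definition is_coequalizer :: "('o, 'a, 'z) category_scheme \<Rightarrow> 'a \<Rightarrow> 'a \<Rightarrow> 'a \<Rightarrow> bool" where
  "is_coequalizer C p q e \<longleftrightarrow>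
     p \<in> Arr C \<and> q \<in> Arr C \<and> e \<in> Arr C \<and>
     Src C p = Src C q \<and> Tgt C p = Tgt C q \<and> Src C e = Tgt C p \<and>
     e \<cdot>\<^bsub>C\<^esub> p = e \<cdot>\<^bsub>C\<^esub> q \<and>
     (\<forall>X x. x \<in> hom C (Tgt C p) X \<and> x \<cdot>\<^bsub>C\<^esub> p = x \<cdot>\<^bsub>C\<^esub> q \<longrightarrow>
        (\<exists>!h. h \<in> hom C (Tgt C e) X \<and> h \<cdot>\<^bsub>C\<^esub> e = x))"

definition regular_epi :: "('o, 'a, 'z) category_scheme \<Rightarrow> 'a \<Rightarrow> bool" where
  "regular_epi C e \<longleftrightarrow> (\<exists>p q. is_coequalizer C p q e)"

locale regular_category = category C
  for C :: "('o, 'a, 'z) category_scheme" (structure) +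
  assumes finite_limits: "has_finite_limits C"
    and kernel_pair_coequalizer: "is_pullback C f f p q \<Longrightarrow> \<exists>e. is_coequalizer C p q e"
    and regular_epi_stable: "is_pullback C e g p q \<Longrightarrow> regular_epi C e \<Longrightarrow> regular_epi C q"

section \<open>Subobjects, images and inhabited objects\<close>

definition monic :: "('o, 'a, 'z) category_scheme \<Rightarrow> 'a \<Rightarrow> bool" where
  "monic C m \<longleftrightarrow> m \<in> Arr C \<and>
     (\<forall>X f g. f \<in> hom C X (Src C m) \<and> g \<in> hom C X (Src C m) \<and> m \<cdot>\<^bsub>C\<^esub> f = m \<cdot>\<^bsub>C\<^esub> g \<longrightarrow> f = g)"

definition factors_through :: "('o, 'a, 'z) category_scheme \<Rightarrow> 'a \<Rightarrow> 'a \<Rightarrow> bool" where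
  "factors_through C f m \<longleftrightarrow> (\<exists>k \<in> hom C (Src C f) (Src C m). m \<cdot>\<^bsub>C\<^esub> k = f)"

text \<open>A subobject of \<open>X\<close> is an equivalence class of monomorphisms into \<open>X\<close> under mutual
  factorization.\<close>

definition sub_class :: "('o, 'a, 'z) category_scheme \<Rightarrow> 'a \<Rightarrow> 'a set" where
  "sub_class C m = {n. monic C n \<and> Tgt C n = Tgt C m \<and> factors_through C n m \<and> factors_through C m n}"

definition subobjects :: "('o, 'a, 'z) category_scheme \<Rightarrow> 'o \<Rightarrow> 'a set set" where
  "subobjects C X = {sub_class C m | m. monic C m \<and> Tgt C m = X}"

text \<open>The image of \<open>f\<close> is the least subobject of its codomain through which \<open>f\<close> factors, here
  given as the set of its representing monomorphisms.\<close>

definition image_sub :: "('o, 'a, 'z) category_scheme \<Rightarrow> 'a \<Rightarrow> 'a set" where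
  "image_sub C f =
     {m. monic C m \<and> Tgt C m = Tgt C f \<and> factors_through C f m \<and>
         (\<forall>n. monic C n \<and> Tgt C n = Tgt C f \<and> factors_through C f n \<longrightarrow> factors_through C m n)}"

definition inhabited :: "('o, 'a, 'z) category_scheme \<Rightarrow> 'o \<Rightarrow> bool" where
  "inhabited C A \<longleftrightarrow>
     (\<forall>T u. is_terminal C T \<and> u \<in> hom C A T \<longrightarrow> image_sub C u = sub_class C (Ident C T))"

definition entirely_inhabited :: "('o, 'a, 'z) category_scheme \<Rightarrow> bool" where
  "entirely_inhabited C \<longleftrightarrow> (\<forall>A \<in> Obj C. inhabited C A)"

section \<open>Dagger monoidal structure\<close>

text \<open>\<open>Assoc A B D\<close> goes from \<open>(A \<odot> B) \<odot> D\<close> to \<open>A \<odot> (B \<odot> D)\<close>, \<open>LUnit A\<close> from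
  \<open>Unit \<odot> A\<close> to \<open>A\<close> and \<open>RUnit A\<close> from \<open>A \<odot> Unit\<close> to \<open>A\<close>. The definitions below only use
  these operations. In a dagger monoidal category the coherence isomorphisms are unitary, so the
  inverse of \<open>Assoc\<close> is its dagger.\<close>

record ('o, 'a) dagger_monoidal = "('o, 'a) category" +
  Dagger :: "'a \<Rightarrow> 'a"
  Unit :: "'o"
  TensorObj :: "'o \<Rightarrow> 'o \<Rightarrow> 'o"  (infixl "\<odot>\<index>" 75)
  Tensor :: "'a \<Rightarrow> 'a \<Rightarrow> 'a"  (infixl "\<otimes>\<index>" 75)
  Assoc :: "'o \<Rightarrow> 'o \<Rightarrow> 'o \<Rightarrow> 'a"
  LUnit :: "'o \<Rightarrow> 'a"
  RUnit :: "'o \<Rightarrow> 'a"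

definition special_dagger_frobenius ::
  "('o, 'a, 'z) dagger_monoidal_scheme \<Rightarrow> 'o \<Rightarrow> 'a \<Rightarrow> 'a \<Rightarrow> bool" where
  "special_dagger_frobenius M A \<mu> \<eta> \<longleftrightarrow>
     A \<in> Obj M \<and> \<mu> \<in> hom M (A \<odot>\<^bsub>M\<^esub> A) A \<and> \<eta> \<in> hom M (Unit M) A \<and>
     \<mu> \<cdot>\<^bsub>M\<^esub> (Ident M A \<otimes>\<^bsub>M\<^esub> \<eta>) = RUnit M A \<and>
     \<mu> \<cdot>\<^bsub>M\<^esub> (\<eta> \<otimes>\<^bsub>M\<^esub> Ident M A) = LUnit M A \<and>
     \<mu> \<cdot>\<^bsub>M\<^esub> (\<mu> \<otimes>\<^bsub>M\<^esub> Ident M A) = \<mu> \<cdot>\<^bsub>M\<^esub> (Ident M A \<otimes>\<^bsub>M\<^esub> \<mu>) \<cdot>\<^bsub>M\<^esub> Assoc M A A A \<and>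
     \<mu> \<cdot>\<^bsub>M\<^esub> Dagger M \<mu> = Ident M A \<and>
     (\<mu> \<otimes>\<^bsub>M\<^esub> Ident M A) \<cdot>\<^bsub>M\<^esub> Dagger M (Assoc M A A A) \<cdot>\<^bsub>M\<^esub> (Ident M A \<otimes>\<^bsub>M\<^esub> Dagger M \<mu>) =
     (Ident M A \<otimes>\<^bsub>M\<^esub> \<mu>) \<cdot>\<^bsub>M\<^esub> Assoc M A A A \<cdot>\<^bsub>M\<^esub> (Dagger M \<mu> \<otimes>\<^bsub>M\<^esub> Ident M A)"

text \<open>The two sides of \<open>Dagger \<mu> \<cdot> H = H \<otimes> H\<close> have domains \<open>Unit\<close> and \<open>Unit \<odot> Unit\<close>, which are
  identified along \<open>LUnit Unit\<close>.\<close>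

definition copyable_state ::
  "('o, 'a, 'z) dagger_monoidal_scheme \<Rightarrow> 'o \<Rightarrow> 'a \<Rightarrow> 'a \<Rightarrow> bool" where
  "copyable_state M A \<mu> H \<longleftrightarrow>
     H \<in> hom M (Unit M) A \<and>
     Dagger M \<mu> \<cdot>\<^bsub>M\<^esub> H \<cdot>\<^bsub>M\<^esub> LUnit M (Unit M) = H \<otimes>\<^bsub>M\<^esub> H"

section \<open>The category of relations\<close>

text \<open>The monoidal structure of \<open>Rel(C)\<close> depends on a choice of terminal object and of binary
  products in \<open>C\<close>; it is part of the data, and arbitrary.\<close>

record ('o, 'a) cartesian_category = "('o, 'a) category" +
  One :: "'o"
  Prod :: "'o \<Rightarrow> 'o \<Rightarrow> 'o"
  Proj1 :: "'o \<Rightarrow> 'o \<Rightarrow> 'a"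
  Proj2 :: "'o \<Rightarrow> 'o \<Rightarrow> 'a"

definition chosen_finite_products :: "('o, 'a, 'z) cartesian_category_scheme \<Rightarrow> bool" where
  "chosen_finite_products C \<longleftrightarrow>
     is_terminal C (One C) \<and>
     (\<forall>A \<in> Obj C. \<forall>B \<in> Obj C. is_product C A B (Prod C A B) (Proj1 C A B) (Proj2 C A B))"

definition pair :: "('o, 'a, 'z) cartesian_category_scheme \<Rightarrow> 'a \<Rightarrow> 'a \<Rightarrow> 'a" where
  "pair C f g =
     (THE h. h \<in> hom C (Src C f) (Prod C (Tgt C f) (Tgt C g)) \<and>
             Proj1 C (Tgt C f) (Tgt C g) \<cdot>\<^bsub>C\<^esub> h = f \<and> Proj2 C (Tgt C f) (Tgt C g) \<cdot>\<^bsub>C\<^esub> h = g)"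

text \<open>A morphism \<open>A \<rightarrow> B\<close> of \<open>Rel(C)\<close> is a subobject of the product of \<open>A\<close> and \<open>B\<close>, tagged with
  its domain and codomain since these need not be recoverable from the product object.\<close>

datatype ('o, 'a) relation = Relation (src: 'o) (tgt: 'o) (sub: "'a set")

definition leg1 :: "('o, 'a, 'z) cartesian_category_scheme \<Rightarrow> ('o, 'a) relation \<Rightarrow> 'a \<Rightarrow> 'a" where
  "leg1 C R r = Proj1 C (src R) (tgt R) \<cdot>\<^bsub>C\<^esub> r"

definition leg2 :: "('o, 'a, 'z) cartesian_category_scheme \<Rightarrow> ('o, 'a) relation \<Rightarrow> 'a \<Rightarrow> 'a" where
  "leg2 C R r = Proj2 C (src R) (tgt R) \<cdot>\<^bsub>C\<^esub> r"

definition graph_rel :: "('o, 'a, 'z) cartesian_category_scheme \<Rightarrow> 'a \<Rightarrow> ('o, 'a) relation" where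
  "graph_rel C f = Relation (Src C f) (Tgt C f) (sub_class C (pair C (Ident C (Src C f)) f))"

text \<open>In the next three definitions all choices of representatives (and of the pullback of \<open>R\<close> and
  \<open>S\<close> over \<open>B\<close>) lead to the same subobject, so collecting over them yields that subobject.\<close>

definition rel_cmp ::
  "('o, 'a, 'z) cartesian_category_scheme \<Rightarrow> ('o, 'a) relation \<Rightarrow> ('o, 'a) relation \<Rightarrow> ('o, 'a) relation" where
  "rel_cmp C S R = Relation (src R) (tgt S)
     {m. \<exists>r \<in> sub R. \<exists>s \<in> sub S. \<exists>p q.
           is_pullback C (leg2 C R r) (leg1 C S s) p q \<and>
           m \<in> image_sub C (pair C (leg1 C R r \<cdot>\<^bsub>C\<^esub> p) (leg2 C S s \<cdot>\<^bsub>C\<^esub> q))}"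

definition rel_dagger ::
  "('o, 'a, 'z) cartesian_category_scheme \<Rightarrow> ('o, 'a) relation \<Rightarrow> ('o, 'a) relation" where
  "rel_dagger C R = Relation (tgt R) (src R)
     {m. \<exists>r \<in> sub R. m \<in> sub_class C (pair C (leg2 C R r) (leg1 C R r))}"

text \<open>For \<open>R : A \<rightarrow> B\<close> and \<open>S : D \<rightarrow> E\<close>, the tensor relates \<open>(a, d)\<close> to \<open>(b, e)\<close> iff
  \<open>R(a, b)\<close> and \<open>S(d, e)\<close>.\<close>

definition rel_tensor ::
  "('o, 'a, 'z) cartesian_category_scheme \<Rightarrow> ('o, 'a) relation \<Rightarrow> ('o, 'a) relation \<Rightarrow> ('o, 'a) relation" where
  "rel_tensor C R S = Relation (Prod C (src R) (src S)) (Prod C (tgt R) (tgt S))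
     {m. \<exists>r \<in> sub R. \<exists>s \<in> sub S.
           let p = Proj1 C (Src C r) (Src C s); q = Proj2 C (Src C r) (Src C s)
           in m \<in> sub_class C
                (pair C (pair C (leg1 C R r \<cdot>\<^bsub>C\<^esub> p) (leg1 C S s \<cdot>\<^bsub>C\<^esub> q))
                        (pair C (leg2 C R r \<cdot>\<^bsub>C\<^esub> p) (leg2 C S s \<cdot>\<^bsub>C\<^esub> q)))}"

definition product_assoc :: "('o, 'a, 'z) cartesian_category_scheme \<Rightarrow> 'o \<Rightarrow> 'o \<Rightarrow> 'o \<Rightarrow> 'a" where
  "product_assoc C A B D =
     pair C (Proj1 C A B \<cdot>\<^bsub>C\<^esub> Proj1 C (Prod C A B) D)
            (pair C (Proj2 C A B \<cdot>\<^bsub>C\<^esub> Proj1 C (Prod C A B) D) (Proj2 C (Prod C A B) D))"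

definition Rel :: "('o, 'a, 'z) cartesian_category_scheme \<Rightarrow> ('o, ('o, 'a) relation) dagger_monoidal" where
  "Rel C =
     \<lparr> Obj = Obj C,
       Arr = {Relation A B X | A B X. A \<in> Obj C \<and> B \<in> Obj C \<and> X \<in> subobjects C (Prod C A B)},
       Src = src,
       Tgt = tgt,
       Ident = (\<lambda>A. graph_rel C (Ident C A)),
       Cmp = rel_cmp C,
       Dagger = rel_dagger C,
       Unit = One C,
       TensorObj = Prod C,
       Tensor = rel_tensor C,
       Assoc = (\<lambda>A B D. graph_rel C (product_assoc C A B D)),
       LUnit = (\<lambda>A. graph_rel C (Proj2 C (One C) A)),
       RUnit = (\<lambda>A. graph_rel C (Proj1 C A (One C))) \<rparr>"

end

theory Submission
  imports Defs
begin

text \<open>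
  Written with elements, the argument is about a partial, many-valued multiplication
  \<open>\<mu>(x, y, z)\<close>, read "\<open>z\<close> is a product of \<open>x\<close> and \<open>y\<close>". That \<open>H\<close> is copyable means:
  \<open>x\<close> and \<open>y\<close> both lie in \<open>H\<close> iff some product of them lies in \<open>H\<close>. Suppose \<open>H\<close> and \<open>T\<close>
  are copyable and have a common element \<open>x\<close>, and let \<open>a\<close> be in \<open>H\<close>. The left unit law gives a
  unit \<open>e\<close> with \<open>\<mu>(e, a, a)\<close>. Copyability of \<open>H\<close> puts \<open>e\<close> into \<open>H\<close>, because the product
  \<open>a\<close> is in \<open>H\<close>. Hence \<open>e\<close> and \<open>x\<close> have a product, which the unit law identifies with
  \<open>x\<close>. Now \<open>\<mu>(e, x, x)\<close> with \<open>x\<close> in \<open>T\<close> puts \<open>e\<close> into \<open>T\<close>. Also \<open>a\<close> and \<open>a\<close>, being in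
  \<open>H\<close>, have a product \<open>b\<close>, and the Frobenius law applied to \<open>\<mu>(e, a, a)\<close> and
  \<open>\<mu>(a, a, b)\<close> yields some \<open>y\<close> with \<open>\<mu>(a, y, e)\<close>: a right inverse of \<open>a\<close>. Since \<open>e\<close> is
  in \<open>T\<close>, copyability of \<open>T\<close> puts \<open>a\<close> into \<open>T\<close>. By symmetry \<open>H = T\<close>. This is
  \<open>member_of_common_member\<close>.

  The common element exists because the category is entirely inhabited: the intersection of \<open>H\<close>
  and \<open>T\<close> is an object \<open>U\<close>, and its map to the terminal object has full image
  (\<open>common_member\<close>, \<open>inhabited_cover\<close>). In sets this is what fails: every
  singleton of objects of a discrete groupoid is copyable, and two of them may be disjoint.

  The reasoning with elements is made precise by Kripke-Joyal semantics. An element of \<open>A\<close> is an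
  arrow \<open>X \<rightarrow> A\<close>, and "there is some \<open>y\<close>" means that \<open>y\<close> exists after restriction along a
  cover of \<open>X\<close>. Two facts carry this. Membership in a subobject is local for covers
  (\<open>holds_local\<close>), so that a witness may be chosen on a cover and dropped at the end. And an
  element of an image lifts to the source after restriction to a cover (\<open>image_sub_local\<close>); this
  rests on the factorization of an arrow into a regular epimorphism and a monomorphism, and on
  stability of regular epimorphisms, and it turns the composition of relations into an existential
  quantifier (\<open>holds_cmpI\<close>, \<open>holds_cmpE\<close>).
\<close>

section \<open>Arrows, monomorphisms and covers\<close>

context category
begin

lemma ident_arr [simp]: "A \<in> Obj C \<Longrightarrow> Ident C A \<in> Arr C"
  and ident_src [simp]: "A \<in> Obj C \<Longrightarrow> Src C (Ident C A) = A"
  and ident_tgt [simp]: "A \<in> Obj C \<Longrightarrow> Tgt C (Ident C A) = A"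
  using ident_hom by (auto simp: hom_def)

lemma cmp_type:
  assumes "f \<in> Arr C" "g \<in> Arr C" "Tgt C f = Src C g"
  shows "g \<cdot> f \<in> Arr C \<and> Src C (g \<cdot> f) = Src C f \<and> Tgt C (g \<cdot> f) = Tgt C g"
  using cmp_hom[of f "Src C f" "Src C g" g "Tgt C g"] assms by (auto simp: hom_def)

lemmas cmp_arr [simp] = cmp_type[THEN conjunct1]
lemmas cmp_src [simp] = cmp_type[THEN conjunct2, THEN conjunct1]
lemmas cmp_tgt [simp] = cmp_type[THEN conjunct2, THEN conjunct2]

lemma cmp_ident_simp [simp]: "f \<in> Arr C \<Longrightarrow> Src C f = A \<Longrightarrow> f \<cdot> Ident C A = f"
  and ident_cmp_simp [simp]: "f \<in> Arr C \<Longrightarrow> Tgt C f = A \<Longrightarrow> Ident C A \<cdot> f = f"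
  using cmp_ident[of f "Src C f" "Tgt C f"] ident_cmp[of f "Src C f" "Tgt C f"]
  by (auto simp: hom_def)

lemma cmp_assoc_simp [simp]:
  assumes "f \<in> Arr C" "g \<in> Arr C" "h \<in> Arr C" "Tgt C f = Src C g" "Tgt C g = Src C h"
  shows "(h \<cdot> g) \<cdot> f = h \<cdot> (g \<cdot> f)"
  using assms cmp_assoc[of f "Src C f" "Src C g" g "Src C h" h "Tgt C h"]
  by (auto simp: hom_def)

text \<open>Composites are normalized to the right by the simplifier, which hides an equation between
  composites inside a longer composite. This form lets such an equation be used there.\<close>

lemma cmp_extend:
  assumes "g \<cdot> f = h" "f \<in> Arr C" "g \<in> Arr C" "x \<in> Arr C" "Tgt C x = Src C f" "Tgt C f = Src C g"
  shows "g \<cdot> (f \<cdot> x) = h \<cdot> x"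
  using assms(2-) by (simp flip: assms(1))

declare src_obj [simp] tgt_obj [simp]

lemma monicD:
  assumes "monic C m" "f \<in> Arr C" "g \<in> Arr C" "Src C f = Src C g"
    "Tgt C f = Src C m" "Tgt C g = Src C m" "m \<cdot> f = m \<cdot> g"
  shows "f = g"
  using assms unfolding monic_def hom_def by auto

lemma monic_arr [simp]: "monic C m \<Longrightarrow> m \<in> Arr C"
  by (simp add: monic_def)

lemma factors_throughE:
  assumes "factors_through C f m"
  obtains k where "k \<in> Arr C" "Src C k = Src C f" "Tgt C k = Src C m" "m \<cdot> k = f"
  using assms by (auto simp: factors_through_def hom_def)

lemma factors_throughI:
  "k \<in> Arr C \<Longrightarrow> Src C k = Src C f \<Longrightarrow> Tgt C k = Src C m \<Longrightarrow> m \<cdot> k = f \<Longrightarrow> factors_through C f m"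
  by (auto simp: factors_through_def hom_def)

lemma factors_through_trans:
  assumes "factors_through C f m" "factors_through C m n" "n \<in> Arr C"
  shows "factors_through C f n"
proof -
  obtain k where k: "k \<in> Arr C" "Src C k = Src C f" "Tgt C k = Src C m" "m \<cdot> k = f"
    using assms(1) by (rule factors_throughE)
  obtain l where l: "l \<in> Arr C" "Src C l = Src C m" "Tgt C l = Src C n" "n \<cdot> l = m"
    using assms(2) by (rule factors_throughE)
  have "n \<cdot> (l \<cdot> k) = (n \<cdot> l) \<cdot> k" using assms(3) k(1-3) l(1-3) by simp
  then show ?thesis
    using k l by (intro factors_throughI[of "l \<cdot> k"]) simp_all
qed

lemma factors_through_refl: "m \<in> Arr C \<Longrightarrow> factors_through C m m"
  unfolding factors_through_def by (rule bexI[of _ "Ident C (Src C m)"]) (auto simp: hom_def)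

lemma factors_through_cmp:
  assumes "factors_through C f m" "m \<in> Arr C" "f \<in> Arr C" "v \<in> Arr C" "Tgt C v = Src C f"
  shows "factors_through C (f \<cdot> v) m"
proof -
  obtain k where k: "k \<in> Arr C" "Src C k = Src C f" "Tgt C k = Src C m" "m \<cdot> k = f"
    using assms(1) by (rule factors_throughE)
  have "m \<cdot> (k \<cdot> v) = (m \<cdot> k) \<cdot> v" using assms(2-) k(1-3) by simp
  then show ?thesis
    using assms(2-) k by (intro factors_throughI[of "k \<cdot> v"]) simp_all
qed

lemma sub_class_self: "monic C m \<Longrightarrow> m \<in> sub_class C m"
  by (simp add: sub_class_def factors_through_refl)

lemma sub_class_eq:
  assumes "monic C m" "monic C n" "Tgt C m = Tgt C n"
    "factors_through C m n" "factors_through C n m"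
  shows "sub_class C m = sub_class C n"
proof -
  have "sub_class C a \<subseteq> sub_class C b"
    if ab: "monic C a" "monic C b" "Tgt C a = Tgt C b" "factors_through C a b"
      "factors_through C b a" for a b
  proof
    fix x
    assume x: "x \<in> sub_class C a"
    then have "factors_through C x a" "factors_through C a x" "x \<in> Arr C"
      by (auto simp: sub_class_def)
    then have "factors_through C x b" "factors_through C b x"
      using ab factors_through_trans monic_arr by metis+
    then show "x \<in> sub_class C b" using x ab by (simp add: sub_class_def)
  qed
  then show ?thesis using assms by (metis subset_antisym)
qed

lemma is_coequalizer_epi:
  assumes e: "is_coequalizer C p q e" and "f \<in> Arr C" "g \<in> Arr C" "Src C f = Tgt C e"
    "Src C g = Tgt C e" "Tgt C f = Tgt C g" "f \<cdot> e = g \<cdot> e"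
  shows "f = g"
proof -
  have e': "p \<in> Arr C" "q \<in> Arr C" "e \<in> Arr C" "Src C p = Src C q" "Tgt C p = Tgt C q"
    "Src C e = Tgt C p" "e \<cdot> p = e \<cdot> q"
    using e by (auto simp: is_coequalizer_def)
  have "f \<cdot> e \<in> hom C (Tgt C p) (Tgt C f)" "(f \<cdot> e) \<cdot> p = (f \<cdot> e) \<cdot> q"
    using assms e' by (auto simp: hom_def)
  then have "\<exists>!h. h \<in> hom C (Tgt C e) (Tgt C f) \<and> h \<cdot> e = f \<cdot> e"
    using e unfolding is_coequalizer_def by blast
  then show ?thesis using assms by (auto simp: hom_def)
qed

lemma regular_epi_epi:
  assumes "regular_epi C e" "f \<in> Arr C" "g \<in> Arr C" "Src C f = Tgt C e"
    "Src C g = Tgt C e" "Tgt C f = Tgt C g" "f \<cdot> e = g \<cdot> e"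
  shows "f = g"
  using assms is_coequalizer_epi unfolding regular_epi_def by blast

text \<open>An extremal epimorphism, given by the property that is needed from it: factoring through a
  subobject can be checked after restriction. Unlike for regular epimorphisms, closure under
  composition is immediate.\<close>

definition cover :: "'a \<Rightarrow> bool" where
  "cover v \<longleftrightarrow> v \<in> Arr C \<and>
     (\<forall>f m. f \<in> Arr C \<and> monic C m \<and> Src C f = Tgt C v \<and> Tgt C f = Tgt C m \<and>
        factors_through C (f \<cdot> v) m \<longrightarrow> factors_through C f m)"

lemma cover_arr [simp]: "cover v \<Longrightarrow> v \<in> Arr C"
  by (simp add: cover_def)

lemma coverD:
  "cover v \<Longrightarrow> f \<in> Arr C \<Longrightarrow> monic C m \<Longrightarrow> Src C f = Tgt C v \<Longrightarrow> Tgt C f = Tgt C m \<Longrightarrow>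
    factors_through C (f \<cdot> v) m \<Longrightarrow> factors_through C f m"
  unfolding cover_def by blast

lemma cover_cmp:
  assumes "cover v" "cover w" "Tgt C w = Src C v"
  shows "cover (v \<cdot> w)"
  unfolding cover_def
proof (intro conjI allI impI; (elim conjE)?)
  fix f m
  assume *: "f \<in> Arr C" "monic C m" "Src C f = Tgt C (v \<cdot> w)" "Tgt C f = Tgt C m"
    "factors_through C (f \<cdot> (v \<cdot> w)) m"
  then have "factors_through C ((f \<cdot> v) \<cdot> w) m" using assms by simp
  then have "factors_through C (f \<cdot> v) m" by (rule coverD[rotated -1]) (use * assms in auto)
  then show "factors_through C f m" by (rule coverD[rotated -1]) (use * assms in auto)
qed (use assms in auto)

text \<open>If \<open>f \<cdot> e = m \<cdot> k\<close> and \<open>e\<close> is the coequalizer of \<open>(p, q)\<close>, then \<open>k\<close> also identifies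
  \<open>p\<close> and \<open>q\<close>, as \<open>m\<close> is monic. So \<open>k\<close> descends along \<open>e\<close>, to a factorization of
  \<open>f\<close>.\<close>

lemma regular_epi_cover:
  assumes "regular_epi C e"
  shows "cover e"
proof -
  obtain p q where co: "is_coequalizer C p q e" using assms by (auto simp: regular_epi_def)
  then have e: "p \<in> Arr C" "q \<in> Arr C" "e \<in> Arr C" "Src C p = Src C q" "Tgt C p = Tgt C q"
    "Src C e = Tgt C p" "e \<cdot> p = e \<cdot> q"
    by (auto simp: is_coequalizer_def)
  have "factors_through C f m"
    if f: "f \<in> Arr C" and m: "monic C m" and ty: "Src C f = Tgt C e" "Tgt C f = Tgt C m"
      and fe: "factors_through C (f \<cdot> e) m" for f m
  proof -
    obtain k where k: "k \<in> Arr C" "Src C k = Src C e" "Tgt C k = Src C m" "m \<cdot> k = f \<cdot> e"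
      using factors_throughE[OF fe] e(3) f ty(1) by (metis cmp_src)
    have "m \<cdot> (k \<cdot> p) = m \<cdot> (k \<cdot> q)" using k(1-3) e f m ty(1) by (simp add: cmp_extend[OF k(4)])
    then have "k \<cdot> p = k \<cdot> q" by (rule monicD[OF m, rotated -1]) (use k(1-3) e(1-6) in simp_all)
    moreover have "k \<in> hom C (Tgt C p) (Src C m)" using k e by (auto simp: hom_def)
    ultimately obtain h where h: "h \<in> hom C (Tgt C e) (Src C m)" "h \<cdot> e = k"
      using co unfolding is_coequalizer_def by blast
    have "(m \<cdot> h) \<cdot> e = m \<cdot> (h \<cdot> e)" using h(1) e m ty by (simp add: hom_def)
    then have "(m \<cdot> h) \<cdot> e = f \<cdot> e" using h(2) k(4) by simp
    then have "m \<cdot> h = f"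
      by (rule is_coequalizer_epi[OF co, rotated -1]) (use h e m f ty in \<open>auto simp: hom_def\<close>)
    then show ?thesis using h(1) ty unfolding factors_through_def by auto
  qed
  then show ?thesis using e unfolding cover_def by blast
qed

end

section \<open>Pullbacks\<close>

text \<open>The objects 0 and 1 both map to 2, by the arrows 3 and 4. The arrows 0, 1 and 2 are the
  identities, so a composite is whichever factor is not an identity.\<close>

definition cospan_shape :: "(nat, nat) category" where
  "cospan_shape = \<lparr> Obj = {0, 1, 2}, Arr = {0, 1, 2, 3, 4},
     Src = (\<lambda>u. if u = 3 then 0 else if u = 4 then 1 else u),
     Tgt = (\<lambda>u. if u = 3 \<or> u = 4 then 2 else u),
     Ident = (\<lambda>i. i),
     Cmp = (\<lambda>v u. if u = 3 \<or> u = 4 then u else v) \<rparr>"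

lemma category_cospan_shape: "category cospan_shape"
  by unfold_locales (auto simp: cospan_shape_def hom_def split: if_splits)

context regular_category
begin

lemma pullback_exists:
  assumes f: "f \<in> Arr C" and g: "g \<in> Arr C" and fg: "Tgt C f = Tgt C g"
  shows "\<exists>p q. is_pullback C f g p q"
proof -
  let ?F0 = "\<lambda>i::nat. if i = 0 then Src C f else if i = 1 then Src C g else Tgt C f"
  let ?F1 = "\<lambda>u::nat. if u = 3 then f else if u = 4 then g else Ident C (?F0 u)"
  have cone: "is_cone cospan_shape C ?F0 ?F1 X c \<longleftrightarrow>
      X \<in> Obj C \<and> c 0 \<in> hom C X (Src C f) \<and> c 1 \<in> hom C X (Src C g) \<and>
      c 2 \<in> hom C X (Tgt C f) \<and> f \<cdot> c 0 = c 2 \<and> g \<cdot> c 1 = c 2" for X c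
    using f g fg by (auto simp: is_cone_def cospan_shape_def hom_def)
  have "is_functor cospan_shape C ?F0 ?F1"
    using f g fg by (auto simp: is_functor_def cospan_shape_def hom_def)
  moreover have "finite (Obj cospan_shape)" "finite (Arr cospan_shape)"
    by (auto simp: cospan_shape_def)
  ultimately obtain X c where lim: "is_limit cospan_shape C ?F0 ?F1 X c"
    using finite_limits category_cospan_shape unfolding has_finite_limits_def by blast
  then have c: "X \<in> Obj C" "c 0 \<in> hom C X (Src C f)" "c 1 \<in> hom C X (Src C g)"
      "c 2 \<in> hom C X (Tgt C f)" "f \<cdot> c 0 = c 2" "g \<cdot> c 1 = c 2"
    unfolding is_limit_def cone by auto
  have "\<exists>!h. h \<in> hom C Y X \<and> c 0 \<cdot> h = x \<and> c 1 \<cdot> h = y"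
    if x: "x \<in> hom C Y (Src C f)" and y: "y \<in> hom C Y (Src C g)" and xy: "f \<cdot> x = g \<cdot> y"
    for Y x y
  proof -
    let ?d = "\<lambda>i::nat. if i = 0 then x else if i = 1 then y else f \<cdot> x"
    have "is_cone cospan_shape C ?F0 ?F1 Y ?d"
      unfolding cone using x y xy f g fg by (auto simp: hom_def)
    then have ex: "\<exists>!h. h \<in> hom C Y X \<and> (\<forall>i \<in> Obj cospan_shape. c i \<cdot> h = ?d i)"
      using lim unfolding is_limit_def by blast
    have eq: "(\<forall>i \<in> Obj cospan_shape. c i \<cdot> h = ?d i) \<longleftrightarrow> c 0 \<cdot> h = x \<and> c 1 \<cdot> h = y"
      if "h \<in> hom C Y X" for h
    proof -
      have "c 2 \<cdot> h = f \<cdot> (c 0 \<cdot> h)"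
        using that c(1-4) f by (simp add: hom_def cmp_extend[OF c(5)])
      then show ?thesis by (auto simp: cospan_shape_def)
    qed
    show ?thesis using ex eq by (metis (no_types, lifting))
  qed
  then have "is_pullback C f g (c 0) (c 1)"
    using c f g fg by (auto simp: is_pullback_def hom_def)
  then show ?thesis by blast
qed

section \<open>Images and the local character of membership\<close>

text \<open>An element \<open>g\<close> of the target of \<open>e\<close> has a preimage, up to restriction along a regular
  epimorphism: take the pullback of \<open>e\<close> along \<open>g\<close>.\<close>

lemma regular_epi_lift:
  assumes e: "regular_epi C e" and g: "g \<in> Arr C" "Tgt C g = Tgt C e"
  obtains v u where "regular_epi C v" "v \<in> Arr C" "u \<in> Arr C" "Tgt C v = Src C g" "Src C u = Src C v"
    "Tgt C u = Src C e" "e \<cdot> u = g \<cdot> v"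
proof -
  have "e \<in> Arr C" using e regular_epi_cover by auto
  then obtain u v where "is_pullback C e g u v" using pullback_exists[of e g] g by auto
  then show thesis using that[of v u] regular_epi_stable[OF _ e] by (auto simp: is_pullback_def)
qed

text \<open>Here \<open>e\<close> is the coequalizer of the kernel pair of \<open>f\<close>. To see that \<open>m\<close> is monic, let
  \<open>m\<close> identify two elements of its source. They lift along \<open>e\<close>, on a cover, to elements that
  \<open>f\<close> identifies; these form an element of the kernel pair, so \<open>e\<close> identifies them too.\<close>

lemma regular_epi_mono_factorization:
  assumes f: "f \<in> Arr C"
  obtains e m where "regular_epi C e" "monic C m" "e \<in> Arr C" "m \<in> Arr C"
    "Src C e = Src C f" "Tgt C e = Src C m" "Tgt C m = Tgt C f" "m \<cdot> e = f"
proof -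
  obtain p q where pb: "is_pullback C f f p q" using pullback_exists[OF f f] by auto
  then obtain e where co: "is_coequalizer C p q e" using kernel_pair_coequalizer by blast
  have p: "p \<in> Arr C" "q \<in> Arr C" "Tgt C p = Src C f" "Tgt C q = Src C f" "Src C p = Src C q"
    "f \<cdot> p = f \<cdot> q"
    using pb by (auto simp: is_pullback_def)
  have e: "e \<in> Arr C" "Src C e = Src C f" "e \<cdot> p = e \<cdot> q"
    using co p by (auto simp: is_coequalizer_def)
  have "f \<in> hom C (Tgt C p) (Tgt C f)" using f p by (simp add: hom_def)
  then obtain m where "m \<in> hom C (Tgt C e) (Tgt C f)" and me: "m \<cdot> e = f"
    using co p unfolding is_coequalizer_def by blast
  then have m: "m \<in> Arr C" "Src C m = Tgt C e" "Tgt C m = Tgt C f" by (auto simp: hom_def)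
  have re: "regular_epi C e" using co by (auto simp: regular_epi_def)
  have "monic C m"
    unfolding monic_def
  proof (intro conjI allI impI m(1); elim conjE)
    fix Z g h
    assume g: "g \<in> hom C Z (Src C m)" and h: "h \<in> hom C Z (Src C m)" and gh: "m \<cdot> g = m \<cdot> h"
    then have gh': "g \<in> Arr C" "Tgt C g = Tgt C e" "Src C g = Z"
      "h \<in> Arr C" "Tgt C h = Tgt C e" "Src C h = Z"
      using m by (auto simp: hom_def)
    \<comment> \<open>\<open>u \<cdot> w\<close> and \<open>t\<close> are lifts of \<open>g\<close> and \<open>h\<close>, both defined on the source of \<open>w\<close>\<close>
    obtain v u where v: "regular_epi C v" "v \<in> Arr C" "Tgt C v = Z"
      and u: "u \<in> Arr C" "Src C u = Src C v" "Tgt C u = Src C e" "e \<cdot> u = g \<cdot> v"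
      using regular_epi_lift[OF re gh'(1,2)] gh'(3) by metis
    have hv: "h \<cdot> v \<in> Arr C" "Tgt C (h \<cdot> v) = Tgt C e" "Src C (h \<cdot> v) = Src C v"
      using gh' v by simp_all
    obtain w t where w: "regular_epi C w" "w \<in> Arr C" "Tgt C w = Src C v"
      and t: "t \<in> Arr C" "Src C t = Src C w" "Tgt C t = Src C e" "e \<cdot> t = (h \<cdot> v) \<cdot> w"
      using regular_epi_lift[OF re hv(1,2)] hv(3) by metis
    have "f \<cdot> (u \<cdot> w) = m \<cdot> (e \<cdot> (u \<cdot> w))"
      using e(1,2) m u(1-3) w by (simp add: cmp_extend[OF me])
    also have "\<dots> = m \<cdot> (g \<cdot> (v \<cdot> w))"
      using e(1,2) m u(1-3) v w g by (simp add: cmp_extend[OF u(4)] hom_def)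
    also have "\<dots> = m \<cdot> (h \<cdot> (v \<cdot> w))"
      using g h v w m by (simp add: cmp_extend[OF gh] cmp_extend[OF refl, of m h] hom_def)
    also have "\<dots> = m \<cdot> (e \<cdot> t)" using h v w m t(4) by (simp add: hom_def)
    also have "\<dots> = f \<cdot> t" using e(1,2) m t(1-3) by (simp add: cmp_extend[OF me])
    finally have "f \<cdot> (u \<cdot> w) = f \<cdot> t" .
    moreover have "u \<cdot> w \<in> hom C (Src C w) (Src C f)" "t \<in> hom C (Src C w) (Src C f)"
      using u w t e by (auto simp: hom_def)
    ultimately obtain k where k: "k \<in> hom C (Src C w) (Src C p)" "p \<cdot> k = u \<cdot> w" "q \<cdot> k = t"
      using pb unfolding is_pullback_def by blast
    have "(g \<cdot> v) \<cdot> w = e \<cdot> (p \<cdot> k)"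
      using u(1-3) w e(1,2) by (simp add: k(2) cmp_extend[OF u(4)])
    also have "\<dots> = e \<cdot> (q \<cdot> k)"
      using p(1-5) e(1,2) k(1)
      by (simp add: hom_def cmp_extend[OF e(3)] cmp_extend[OF refl, of e q])
    finally have "(g \<cdot> v) \<cdot> w = (h \<cdot> v) \<cdot> w" using t(4) k(3) by simp
    then have "g \<cdot> v = h \<cdot> v"
      by (rule regular_epi_epi[OF w(1), rotated -1]) (use g h v w in \<open>auto simp: hom_def\<close>)
    then show "g = h"
      by (rule regular_epi_epi[OF v(1), rotated -1]) (use g h v w in \<open>auto simp: hom_def\<close>)
  qed
  then show thesis using that[of e m] re e m me by simp
qed

text \<open>Belonging to the image of \<open>f\<close> is the existence of a preimage on a cover. The image is least
  among the subobjects through which \<open>f\<close> factors, so it is contained in the monic part of the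
  factorization of \<open>f\<close>, and elements of the latter lift along the regular epimorphism.\<close>

lemma image_sub_local:
  assumes f: "f \<in> Arr C" and m: "m \<in> image_sub C f" and x: "x \<in> Arr C" "Tgt C x = Tgt C f"
    and fac: "factors_through C x m"
  obtains v w where "cover v" "Tgt C v = Src C x" "w \<in> hom C (Src C v) (Src C f)" "f \<cdot> w = x \<cdot> v"
proof -
  obtain e n where e: "regular_epi C e" "monic C n" "e \<in> Arr C" "n \<in> Arr C"
    "Src C e = Src C f" "Tgt C e = Src C n" "Tgt C n = Tgt C f" "n \<cdot> e = f"
    using regular_epi_mono_factorization[OF f] .
  have "factors_through C f n"
    using e by (intro factors_throughI[of e])
  then have "factors_through C m n" using m e unfolding image_sub_def by blast
  with fac have "factors_through C x n" using factors_through_trans e by blast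
  then obtain k where k: "k \<in> Arr C" "Src C k = Src C x" "Tgt C k = Src C n" "n \<cdot> k = x"
    by (rule factors_throughE)
  obtain v u where v: "regular_epi C v" "v \<in> Arr C" "u \<in> Arr C" "Tgt C v = Src C x"
    "Src C u = Src C v" "Tgt C u = Src C e" "e \<cdot> u = k \<cdot> v"
    using regular_epi_lift[OF e(1) k(1)] k(2,3) e(6) by metis
  have "f \<cdot> u = n \<cdot> (e \<cdot> u)" using e(3-7) v(2-6) by (simp add: cmp_extend[OF e(8)])
  also have "\<dots> = x \<cdot> v"
    using k(1-3) e(3-7) v(2-6) by (simp add: v(7) cmp_extend[OF k(4)])
  finally have "f \<cdot> u = x \<cdot> v" .
  then show thesis using that[of v u] v e regular_epi_cover by (auto simp: hom_def)
qed

lemma image_sub_exists: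
  assumes f: "f \<in> Arr C"
  obtains m where "m \<in> image_sub C f"
proof -
  obtain e m where e: "regular_epi C e" "monic C m" "e \<in> Arr C" "m \<in> Arr C"
    "Src C e = Src C f" "Tgt C e = Src C m" "Tgt C m = Tgt C f" "m \<cdot> e = f"
    using regular_epi_mono_factorization[OF f] .
  have "factors_through C f m"
    using e by (intro factors_throughI[of e])
  moreover have "factors_through C m n"
    if "monic C n" "Tgt C n = Tgt C f" "factors_through C f n" for n
    by (rule coverD[OF regular_epi_cover[OF e(1)]]) (use e that in auto)
  ultimately have "m \<in> image_sub C f" using e by (auto simp: image_sub_def)
  then show thesis using that by blast
qed

end

section \<open>Finite products\<close>

locale regular_cartesian_category = regular_category C
  for C :: "('o, 'a, 'z) cartesian_category_scheme" (structure) +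
  assumes finite_products: "chosen_finite_products C"
begin

definition bang :: "'o \<Rightarrow> 'a" where
  "bang X = (THE u. u \<in> hom C X (One C))"

lemma one_obj [simp]: "One C \<in> Obj C"
  using finite_products by (simp add: chosen_finite_products_def is_terminal_def)

lemma bang_hom: "X \<in> Obj C \<Longrightarrow> bang X \<in> hom C X (One C)"
  unfolding bang_def using finite_products
  by (intro theI'[of "\<lambda>u. u \<in> hom C X (One C)"])
    (simp add: chosen_finite_products_def is_terminal_def)

lemma bang_simps [simp]:
  "X \<in> Obj C \<Longrightarrow> bang X \<in> Arr C"
  "X \<in> Obj C \<Longrightarrow> Src C (bang X) = X"
  "X \<in> Obj C \<Longrightarrow> Tgt C (bang X) = One C"
  using bang_hom by (auto simp: hom_def)

lemma bang_unique:
  assumes "f \<in> Arr C" "Tgt C f = One C"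
  shows "f = bang (Src C f)"
proof -
  have "\<exists>!u. u \<in> hom C (Src C f) (One C)"
    using finite_products assms by (simp add: chosen_finite_products_def is_terminal_def)
  moreover have "f \<in> hom C (Src C f) (One C)" using assms by (simp add: hom_def)
  ultimately show ?thesis using bang_hom[of "Src C f"] assms by auto
qed

lemma bang_cmp [simp]: "v \<in> Arr C \<Longrightarrow> Tgt C v = X \<Longrightarrow> bang X \<cdot> v = bang (Src C v)"
  using bang_unique[of "bang X \<cdot> v"] by auto

lemma product:
  "A \<in> Obj C \<Longrightarrow> B \<in> Obj C \<Longrightarrow> is_product C A B (Prod C A B) (Proj1 C A B) (Proj2 C A B)"
  using finite_products by (simp add: chosen_finite_products_def)

lemma proj_simps [simp]:
  assumes "A \<in> Obj C" "B \<in> Obj C"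
  shows "Proj1 C A B \<in> Arr C" "Proj2 C A B \<in> Arr C"
    "Src C (Proj1 C A B) = Prod C A B" "Src C (Proj2 C A B) = Prod C A B"
    "Tgt C (Proj1 C A B) = A" "Tgt C (Proj2 C A B) = B"
  using product[OF assms] by (auto simp: is_product_def hom_def)

lemma prod_obj [simp]: "A \<in> Obj C \<Longrightarrow> B \<in> Obj C \<Longrightarrow> Prod C A B \<in> Obj C"
  using src_obj[of "Proj1 C A B"] by simp

lemma prod_ext:
  assumes "A \<in> Obj C" "B \<in> Obj C" "h \<in> hom C X (Prod C A B)" "k \<in> hom C X (Prod C A B)"
    "Proj1 C A B \<cdot> h = Proj1 C A B \<cdot> k" "Proj2 C A B \<cdot> h = Proj2 C A B \<cdot> k"
  shows "h = k"
proof -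
  have "Proj1 C A B \<cdot> k \<in> hom C X A" "Proj2 C A B \<cdot> k \<in> hom C X B"
    using assms by (auto simp: hom_def)
  then have "\<exists>!h. h \<in> hom C X (Prod C A B) \<and> Proj1 C A B \<cdot> h = Proj1 C A B \<cdot> k \<and>
      Proj2 C A B \<cdot> h = Proj2 C A B \<cdot> k"
    using product[OF assms(1,2)] unfolding is_product_def by blast
  then show ?thesis using assms by blast
qed

lemma pair_type:
  assumes "f \<in> Arr C" "g \<in> Arr C" "Src C f = Src C g"
  shows "pair C f g \<in> hom C (Src C f) (Prod C (Tgt C f) (Tgt C g)) \<and>
    Proj1 C (Tgt C f) (Tgt C g) \<cdot> pair C f g = f \<and> Proj2 C (Tgt C f) (Tgt C g) \<cdot> pair C f g = g"
proof -
  have "f \<in> hom C (Src C f) (Tgt C f)" "g \<in> hom C (Src C f) (Tgt C g)"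
    using assms by (auto simp: hom_def)
  then have "\<exists>!h. h \<in> hom C (Src C f) (Prod C (Tgt C f) (Tgt C g)) \<and>
      Proj1 C (Tgt C f) (Tgt C g) \<cdot> h = f \<and> Proj2 C (Tgt C f) (Tgt C g) \<cdot> h = g"
    using product[of "Tgt C f" "Tgt C g"] assms unfolding is_product_def by simp
  from theI'[OF this] show ?thesis unfolding pair_def .
qed

lemma pair_simps [simp]:
  assumes "f \<in> Arr C" "g \<in> Arr C" "Src C f = Src C g"
  shows "pair C f g \<in> Arr C" "Src C (pair C f g) = Src C f"
    "Tgt C (pair C f g) = Prod C (Tgt C f) (Tgt C g)"
    "Tgt C f = A \<Longrightarrow> Tgt C g = B \<Longrightarrow> Proj1 C A B \<cdot> pair C f g = f"
    "Tgt C f = A \<Longrightarrow> Tgt C g = B \<Longrightarrow> Proj2 C A B \<cdot> pair C f g = g"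
  using pair_type[OF assms] by (auto simp: hom_def)

lemma pair_unique:
  assumes "A \<in> Obj C" "B \<in> Obj C" "h \<in> Arr C" "Tgt C h = Prod C A B"
    "Proj1 C A B \<cdot> h = f" "Proj2 C A B \<cdot> h = g"
  shows "pair C f g = h"
proof -
  have "f \<in> Arr C" "Src C f = Src C h" "Tgt C f = A" "g \<in> Arr C" "Src C g = Src C h" "Tgt C g = B"
    using assms(1-4) by (simp_all flip: assms(5,6))
  then show ?thesis
    by - (rule prod_ext[of A B _ "Src C h"], use assms in \<open>simp_all add: hom_def\<close>)
qed

lemma pair_cmp [simp]:
  assumes "f \<in> Arr C" "g \<in> Arr C" "Src C f = Src C g" "v \<in> Arr C" "Tgt C v = Src C f"
  shows "pair C f g \<cdot> v = pair C (f \<cdot> v) (g \<cdot> v)"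
proof -
  have "Proj1 C (Tgt C f) (Tgt C g) \<cdot> (pair C f g \<cdot> v) = f \<cdot> v"
    "Proj2 C (Tgt C f) (Tgt C g) \<cdot> (pair C f g \<cdot> v) = g \<cdot> v"
    using assms by (simp_all add: cmp_extend[of _ "pair C f g" f] cmp_extend[of _ "pair C f g" g])
  then show ?thesis
    using assms by - (rule pair_unique[symmetric, of "Tgt C f" "Tgt C g"], simp_all)
qed

section \<open>Relations and generalized elements\<close>

text \<open>Weaker than being an arrow of \<open>Rel(C)\<close>: the monomorphisms need not form one equivalence
  class. This suffices to interpret relations on elements, and it is visibly preserved by the
  operations on relations, since each of them collects monomorphisms.\<close>

definition wf_rel :: "('o, 'a) relation \<Rightarrow> 'o \<Rightarrow> 'o \<Rightarrow> bool" where
  "wf_rel R A B \<longleftrightarrow> src R = A \<and> tgt R = B \<and> A \<in> Obj C \<and> B \<in> Obj C \<and>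
     (\<forall>r \<in> sub R. monic C r \<and> Tgt C r = Prod C A B)"

text \<open>Generalized elements \<open>x : X \<rightarrow> A\<close> and \<open>y : X \<rightarrow> B\<close> are related by \<open>R\<close>.\<close>

definition holds :: "('o, 'a) relation \<Rightarrow> 'a \<Rightarrow> 'a \<Rightarrow> bool" where
  "holds R x y \<longleftrightarrow> (\<exists>r \<in> sub R. factors_through C (pair C x y) r)"

lemma wf_relD:
  assumes "wf_rel R A B"
  shows "A \<in> Obj C" "B \<in> Obj C" "r \<in> sub R \<Longrightarrow> monic C r"
    "r \<in> sub R \<Longrightarrow> Tgt C r = Prod C A B" "src R = A" "tgt R = B"
  using assms by (auto simp: wf_rel_def)

lemma leg_simps:
  assumes "wf_rel R A B" "r \<in> sub R"
  shows "leg1 C R r \<in> Arr C" "Src C (leg1 C R r) = Src C r" "Tgt C (leg1 C R r) = A"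
    "leg2 C R r \<in> Arr C" "Src C (leg2 C R r) = Src C r" "Tgt C (leg2 C R r) = B"
    "pair C (leg1 C R r) (leg2 C R r) = r"
  using wf_relD[OF assms(1)] assms(2)
  by (simp_all add: leg1_def leg2_def pair_unique[of A B])

lemma pair_eq_iff:
  assumes "f \<in> Arr C" "g \<in> Arr C" "Src C f = Src C g" "f' \<in> Arr C" "g' \<in> Arr C" "Src C f' = Src C g'"
    "Tgt C f = Tgt C f'" "Tgt C g = Tgt C g'"
  shows "pair C f g = pair C f' g' \<longleftrightarrow> f = f' \<and> g = g'"
  using pair_simps(4,5)[OF assms(1-3) refl refl] pair_simps(4,5)[OF assms(4-6) refl refl] assms(7,8)
  by metis

lemma factors_through_pair_iff:
  assumes "a \<in> hom C S A" "b \<in> hom C S B" "x \<in> hom C X A" "y \<in> hom C X B"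
  shows "factors_through C (pair C x y) (pair C a b) \<longleftrightarrow>
    (\<exists>k \<in> hom C X S. a \<cdot> k = x \<and> b \<cdot> k = y)"
  unfolding factors_through_def using assms by (auto simp: hom_def pair_eq_iff)

lemma holds_iff:
  assumes "wf_rel R A B" "x \<in> hom C X A" "y \<in> hom C X B"
  shows "holds R x y \<longleftrightarrow>
    (\<exists>r \<in> sub R. \<exists>k \<in> hom C X (Src C r). leg1 C R r \<cdot> k = x \<and> leg2 C R r \<cdot> k = y)"
proof -
  have "factors_through C (pair C x y) r \<longleftrightarrow>
      (\<exists>k \<in> hom C X (Src C r). leg1 C R r \<cdot> k = x \<and> leg2 C R r \<cdot> k = y)" if "r \<in> sub R" for r
    using factors_through_pair_iff[of "leg1 C R r" "Src C r" A "leg2 C R r" B x X y]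
      leg_simps[OF assms(1) that] assms(2,3) by (simp add: hom_def)
  then show ?thesis by (simp add: holds_def)
qed

lemma legs_jointly_monic:
  assumes "wf_rel R A B" "r \<in> sub R" "k \<in> hom C X (Src C r)" "l \<in> hom C X (Src C r)"
    "leg1 C R r \<cdot> k = leg1 C R r \<cdot> l" "leg2 C R r \<cdot> k = leg2 C R r \<cdot> l"
  shows "k = l"
proof -
  note leg = leg_simps[OF assms(1,2)]
  have "r \<cdot> k = r \<cdot> l"
    using assms(3-6) leg(1-6) pair_cmp[of "leg1 C R r" "leg2 C R r" k]
      pair_cmp[of "leg1 C R r" "leg2 C R r" l]
    unfolding leg(7) by (simp add: hom_def)
  then show ?thesis
    using wf_relD(3)[OF assms(1,2)] assms(3,4)
    by - (rule monicD[of r k l], simp_all add: hom_def)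
qed

lemma monic_pairI:
  assumes "a \<in> hom C S A" "b \<in> hom C S B"
    and "\<And>X k l. k \<in> hom C X S \<Longrightarrow> l \<in> hom C X S \<Longrightarrow> a \<cdot> k = a \<cdot> l \<Longrightarrow> b \<cdot> k = b \<cdot> l \<Longrightarrow> k = l"
  shows "monic C (pair C a b)"
  unfolding monic_def using assms by (auto simp: hom_def pair_eq_iff)

lemma factors_through_sub_class_iff:
  assumes "monic C n" "m \<in> sub_class C n"
  shows "factors_through C f m \<longleftrightarrow> factors_through C f n"
  using assms factors_through_trans[of f m n] factors_through_trans[of f n m]
  by (auto simp: sub_class_def)

lemma Rel_simps [simp]:
  "Obj (Rel C) = Obj C" "Cmp (Rel C) = rel_cmp C" "Ident (Rel C) A = graph_rel C (Ident C A)"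
  "Dagger (Rel C) = rel_dagger C" "Unit (Rel C) = One C" "TensorObj (Rel C) = Prod C"
  "Tensor (Rel C) = rel_tensor C" "Assoc (Rel C) A B D = graph_rel C (product_assoc C A B D)"
  "LUnit (Rel C) A = graph_rel C (Proj2 C (One C) A)"
  by (simp_all add: Rel_def)

lemma pair_cases:
  assumes "A \<in> Obj C" "B \<in> Obj C" "h \<in> hom C X (Prod C A B)"
  obtains f g where "f \<in> hom C X A" "g \<in> hom C X B" "h = pair C f g"
  using that[of "Proj1 C A B \<cdot> h" "Proj2 C A B \<cdot> h"] assms
    pair_unique[OF assms(1,2), of h, OF _ _ refl refl] by (auto simp: hom_def)

text \<open>Truth is stable under restriction of the elements, and it may be tested on a cover. The
  latter is what the definition of a cover provides, as \<open>R\<close> consists of monomorphisms.\<close>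

lemma holds_restrict:
  assumes "wf_rel R A B" "x \<in> hom C X A" "y \<in> hom C X B" "v \<in> Arr C" "Tgt C v = X"
    "holds R x y"
  shows "holds R (x \<cdot> v) (y \<cdot> v)"
proof -
  obtain r where r: "r \<in> sub R" "factors_through C (pair C x y) r"
    using assms(6) by (auto simp: holds_def)
  have "factors_through C (pair C x y \<cdot> v) r"
    using r wf_relD(3)[OF assms(1)] assms(2-5)
    by (intro factors_through_cmp) (auto simp: hom_def)
  then show ?thesis using r(1) assms(2-5) by (auto simp: holds_def hom_def)
qed

lemma holds_local:
  assumes "wf_rel R A B" "x \<in> hom C X A" "y \<in> hom C X B" "cover v" "Tgt C v = X"
    "holds R (x \<cdot> v) (y \<cdot> v)"
  shows "holds R x y"
proof -
  obtain r where r: "r \<in> sub R" "factors_through C (pair C (x \<cdot> v) (y \<cdot> v)) r"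
    using assms(6) by (auto simp: holds_def)
  have "factors_through C (pair C x y) r"
    by (rule coverD[OF assms(4)])
      (use r wf_relD(3,4)[OF assms(1) r(1)] assms(2-5) in \<open>auto simp: hom_def\<close>)
  then show ?thesis using r(1) by (auto simp: holds_def)
qed

lemma wf_rel_Rel:
  assumes "R \<in> hom (Rel C) A B"
  shows "wf_rel R A B"
  using assms by (auto simp: wf_rel_def Rel_def hom_def subobjects_def sub_class_def)

lemma wf_rel_dagger:
  assumes "wf_rel R A B"
  shows "wf_rel (rel_dagger C R) B A"
  using wf_relD[OF assms] leg_simps[OF assms]
  by (auto simp: wf_rel_def rel_dagger_def sub_class_def)

text \<open>The operations on relations receive their meaning on elements. For the dagger, graphs and the
  tensor the subobject is given by a span; it remains to see that the span is jointly monic, since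
  otherwise its class of monomorphisms would be empty.\<close>

lemma holds_dagger:
  assumes R: "wf_rel R A B" and x: "x \<in> hom C X A" and y: "y \<in> hom C X B"
  shows "holds (rel_dagger C R) y x \<longleftrightarrow> holds R x y"
proof -
  have "(\<exists>m \<in> sub_class C (pair C (leg2 C R r) (leg1 C R r)). factors_through C (pair C y x) m) \<longleftrightarrow>
      (\<exists>k \<in> hom C X (Src C r). leg1 C R r \<cdot> k = x \<and> leg2 C R r \<cdot> k = y)"
    if r: "r \<in> sub R" for r
  proof -
    have leg: "leg1 C R r \<in> hom C (Src C r) A" "leg2 C R r \<in> hom C (Src C r) B"
      using leg_simps[OF R r] by (auto simp: hom_def)
    have mono: "monic C (pair C (leg2 C R r) (leg1 C R r))"
      using leg by (intro monic_pairI) (auto intro: legs_jointly_monic[OF R r])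
    show ?thesis
      using factors_through_sub_class_iff[OF mono] sub_class_self[OF mono]
        factors_through_pair_iff[OF leg(2,1) y x] by blast
  qed
  then show ?thesis unfolding holds_iff[OF R x y] unfolding holds_def rel_dagger_def by simp blast
qed

lemma wf_graph_rel:
  assumes "f \<in> hom C A B"
  shows "wf_rel (graph_rel C f) A B"
  using assms by (auto simp: wf_rel_def graph_rel_def sub_class_def hom_def)

lemma holds_graph:
  assumes f: "f \<in> hom C A B" and x: "x \<in> hom C X A" and y: "y \<in> hom C X B"
  shows "holds (graph_rel C f) x y \<longleftrightarrow> f \<cdot> x = y"
proof -
  have AB: "A \<in> Obj C" "Src C f = A" "Tgt C f = B" using f by (auto simp: hom_def)
  have leg: "Ident C A \<in> hom C A A"
    using AB by (auto simp: hom_def)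
  have mono: "monic C (pair C (Ident C A) f)"
    by (rule monic_pairI[OF leg f]) (auto simp: hom_def)
  have "(\<exists>k \<in> hom C X A. Ident C A \<cdot> k = x \<and> f \<cdot> k = y) \<longleftrightarrow> f \<cdot> x = y"
    using x f by (auto simp: hom_def)
  moreover have "holds (graph_rel C f) x y \<longleftrightarrow>
      factors_through C (pair C x y) (pair C (Ident C A) f)"
    using factors_through_sub_class_iff[OF mono] sub_class_self[OF mono]
    unfolding holds_def graph_rel_def relation.sel AB by blast
  ultimately show ?thesis unfolding factors_through_pair_iff[OF leg f x y] by simp
qed

lemma wf_rel_tensor:
  assumes "wf_rel R A B" "wf_rel S D E"
  shows "wf_rel (rel_tensor C R S) (Prod C A D) (Prod C B E)"
  using wf_relD[OF assms(1)] leg_simps[OF assms(1)] wf_relD[OF assms(2)] leg_simps[OF assms(2)]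
  by (auto simp: wf_rel_def rel_tensor_def sub_class_def Let_def)

lemma holds_tensor:
  assumes R: "wf_rel R A B" and S: "wf_rel S D E"
    and x: "x \<in> hom C X A" "x' \<in> hom C X D"
    and y: "y \<in> hom C X B" "y' \<in> hom C X E"
  shows "holds (rel_tensor C R S) (pair C x x') (pair C y y') \<longleftrightarrow> holds R x y \<and> holds S x' y'"
proof -
  define F where "F r s = pair C
      (pair C (leg1 C R r \<cdot> Proj1 C (Src C r) (Src C s)) (leg1 C S s \<cdot> Proj2 C (Src C r) (Src C s)))
      (pair C (leg2 C R r \<cdot> Proj1 C (Src C r) (Src C s)) (leg2 C S s \<cdot> Proj2 C (Src C r) (Src C s)))"
    for r s
  have "(\<exists>m \<in> sub_class C (F r s). factors_through C (pair C (pair C x x') (pair C y y')) m) \<longleftrightarrow>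
      (\<exists>k \<in> hom C X (Src C r). leg1 C R r \<cdot> k = x \<and> leg2 C R r \<cdot> k = y) \<and>
      (\<exists>l \<in> hom C X (Src C s). leg1 C S s \<cdot> l = x' \<and> leg2 C S s \<cdot> l = y')"
    (is "?lhs \<longleftrightarrow> ?rhs") if r: "r \<in> sub R" and s: "s \<in> sub S" for r s
  proof -
    note lr = leg_simps(1-6)[OF R r] and ls = leg_simps(1-6)[OF S s]
    have obj: "Src C r \<in> Obj C" "Src C s \<in> Obj C"
      using wf_relD(3)[OF R r] wf_relD(3)[OF S s] by simp_all
    let ?P = "Prod C (Src C r) (Src C s)"
    let ?p = "Proj1 C (Src C r) (Src C s)" and ?q = "Proj2 C (Src C r) (Src C s)"
    let ?a = "pair C (leg1 C R r \<cdot> ?p) (leg1 C S s \<cdot> ?q)"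
    let ?b = "pair C (leg2 C R r \<cdot> ?p) (leg2 C S s \<cdot> ?q)"
    have leg: "?a \<in> hom C ?P (Prod C A D)" "?b \<in> hom C ?P (Prod C B E)"
      using lr ls obj by (auto simp: hom_def)
    \<comment> \<open>an element \<open>h\<close> of the product is a witness iff its two components are separately\<close>
    have split: "?a \<cdot> h = pair C u u' \<and> ?b \<cdot> h = pair C w w' \<longleftrightarrow>
        (leg1 C R r \<cdot> (?p \<cdot> h) = u \<and> leg2 C R r \<cdot> (?p \<cdot> h) = w) \<and>
        (leg1 C S s \<cdot> (?q \<cdot> h) = u' \<and> leg2 C S s \<cdot> (?q \<cdot> h) = w')"
      if "h \<in> hom C Y ?P" "u \<in> hom C Y A" "u' \<in> hom C Y D" "w \<in> hom C Y B"
        "w' \<in> hom C Y E" for Y h u u' w w'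
      using that lr ls obj by (auto simp: hom_def pair_eq_iff)
    have mono: "monic C (F r s)"
      unfolding F_def
    proof (rule monic_pairI[OF leg])
      fix Y k l
      assume k: "k \<in> hom C Y ?P" and l: "l \<in> hom C Y ?P" and eq: "?a \<cdot> k = ?a \<cdot> l" "?b \<cdot> k = ?b \<cdot> l"
      have l': "?a \<cdot> l = pair C (leg1 C R r \<cdot> (?p \<cdot> l)) (leg1 C S s \<cdot> (?q \<cdot> l))"
        "?b \<cdot> l = pair C (leg2 C R r \<cdot> (?p \<cdot> l)) (leg2 C S s \<cdot> (?q \<cdot> l))"
        using l lr ls obj by (simp_all add: hom_def)
      have ty: "?p \<cdot> k \<in> hom C Y (Src C r)" "?p \<cdot> l \<in> hom C Y (Src C r)"
        "?q \<cdot> k \<in> hom C Y (Src C s)" "?q \<cdot> l \<in> hom C Y (Src C s)"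
        using k l obj by (auto simp: hom_def)
      have "(leg1 C R r \<cdot> (?p \<cdot> k) = leg1 C R r \<cdot> (?p \<cdot> l) \<and>
             leg2 C R r \<cdot> (?p \<cdot> k) = leg2 C R r \<cdot> (?p \<cdot> l)) \<and>
            (leg1 C S s \<cdot> (?q \<cdot> k) = leg1 C S s \<cdot> (?q \<cdot> l) \<and>
             leg2 C S s \<cdot> (?q \<cdot> k) = leg2 C S s \<cdot> (?q \<cdot> l))"
        using eq unfolding l'
        by (intro split[OF k, THEN iffD1]) (use ty lr ls in \<open>auto simp: hom_def\<close>)
      then have "?p \<cdot> k = ?p \<cdot> l" "?q \<cdot> k = ?q \<cdot> l"
        using legs_jointly_monic[OF R r ty(1,2)] legs_jointly_monic[OF S s ty(3,4)] by blast+
      then show "k = l" using prod_ext[OF obj k l] by blast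
    qed
    have "?lhs \<longleftrightarrow> factors_through C (pair C (pair C x x') (pair C y y')) (F r s)"
      using factors_through_sub_class_iff[OF mono] sub_class_self[OF mono] by blast
    also have "\<dots> \<longleftrightarrow> (\<exists>h \<in> hom C X ?P. ?a \<cdot> h = pair C x x' \<and> ?b \<cdot> h = pair C y y')"
      unfolding F_def
      by (rule factors_through_pair_iff[OF leg]) (use x y in \<open>auto simp: hom_def\<close>)
    also have "\<dots> \<longleftrightarrow> ?rhs"
    proof
      assume "\<exists>h \<in> hom C X ?P. ?a \<cdot> h = pair C x x' \<and> ?b \<cdot> h = pair C y y'"
      then obtain h where h: "h \<in> hom C X ?P" "?a \<cdot> h = pair C x x' \<and> ?b \<cdot> h = pair C y y'" by blast
      have "?p \<cdot> h \<in> hom C X (Src C r)" "?q \<cdot> h \<in> hom C X (Src C s)"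
        using h(1) obj by (auto simp: hom_def)
      then show ?rhs using h(2) unfolding split[OF h(1) x y] by blast
    next
      assume ?rhs
      then obtain k l where k: "k \<in> hom C X (Src C r)" "leg1 C R r \<cdot> k = x" "leg2 C R r \<cdot> k = y"
        and l: "l \<in> hom C X (Src C s)" "leg1 C S s \<cdot> l = x'" "leg2 C S s \<cdot> l = y'"
        by blast
      have h: "pair C k l \<in> hom C X ?P" "?p \<cdot> pair C k l = k" "?q \<cdot> pair C k l = l"
        using k(1) l(1) by (auto simp: hom_def)
      show "\<exists>h \<in> hom C X ?P. ?a \<cdot> h = pair C x x' \<and> ?b \<cdot> h = pair C y y'"
        by (rule bexI[OF _ h(1)]) (unfold split[OF h(1) x y] h(2,3), use k l in blast)
    qed
    finally show ?thesis .
  qed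
  note * = this
  have "holds (rel_tensor C R S) (pair C x x') (pair C y y') \<longleftrightarrow>
      (\<exists>r \<in> sub R. \<exists>s \<in> sub S. \<exists>m \<in> sub_class C (F r s).
         factors_through C (pair C (pair C x x') (pair C y y')) m)"
    unfolding holds_def rel_tensor_def F_def Let_def by auto
  also have "\<dots> \<longleftrightarrow> holds R x y \<and> holds S x' y'"
    unfolding holds_iff[OF R x(1) y(1)] holds_iff[OF S x(2) y(2)] by (auto simp: *)
  finally show ?thesis .
qed

lemma wf_rel_cmp:
  assumes R: "wf_rel R A B" and S: "wf_rel S B D"
  shows "wf_rel (rel_cmp C S R) A D"
proof -
  have "monic C m \<and> Tgt C m = Prod C A D"
    if "r \<in> sub R" "s \<in> sub S" "is_pullback C (leg2 C R r) (leg1 C S s) p q"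
      "m \<in> image_sub C (pair C (leg1 C R r \<cdot> p) (leg2 C S s \<cdot> q))" for r s p q m
    using that leg_simps[OF R that(1)] leg_simps[OF S that(2)]
    by (auto simp: image_sub_def is_pullback_def)
  then show ?thesis
    using wf_relD[OF R] wf_relD[OF S] by (auto simp: wf_rel_def rel_cmp_def)
qed

text \<open>\<open>R\<close> followed by \<open>S\<close> relates \<open>x\<close> and \<open>z\<close> iff some \<open>y\<close> lies in between. The
  middle element is part of an element of the pullback of \<open>R\<close> and \<open>S\<close>; passing to the image
  forgets it, so it can be recovered on a cover only.\<close>

lemma holds_cmpI:
  assumes R: "wf_rel R A B" and S: "wf_rel S B D"
    and x: "x \<in> hom C X A" and y: "y \<in> hom C X B" and z: "z \<in> hom C X D"
    and xy: "holds R x y" and yz: "holds S y z"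
  shows "holds (rel_cmp C S R) x z"
proof -
  obtain r k where r: "r \<in> sub R" and k: "k \<in> hom C X (Src C r)"
    "leg1 C R r \<cdot> k = x" "leg2 C R r \<cdot> k = y"
    using xy unfolding holds_iff[OF R x y] by blast
  have "y \<in> hom C X B" using y by simp
  then obtain s l where s: "s \<in> sub S" and l: "l \<in> hom C X (Src C s)"
    "leg1 C S s \<cdot> l = y" "leg2 C S s \<cdot> l = z"
    using yz z holds_iff[OF S] by blast
  note lr = leg_simps(1-6)[OF R r] and ls = leg_simps(1-6)[OF S s]
  obtain p q where pb: "is_pullback C (leg2 C R r) (leg1 C S s) p q"
    using pullback_exists[of "leg2 C R r" "leg1 C S s"] lr ls by auto
  then have pq: "p \<in> Arr C" "q \<in> Arr C" "Tgt C p = Src C r" "Tgt C q = Src C s" "Src C p = Src C q"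
    using lr ls by (auto simp: is_pullback_def)
  obtain h where h: "h \<in> hom C X (Src C p)" "p \<cdot> h = k" "q \<cdot> h = l"
    using pb k l lr ls unfolding is_pullback_def by metis
  let ?f = "pair C (leg1 C R r \<cdot> p) (leg2 C S s \<cdot> q)"
  have f: "?f \<in> Arr C" "Src C ?f = Src C p" using pq lr ls by simp_all
  obtain m where m: "m \<in> image_sub C ?f" using image_sub_exists[OF f(1)] .
  have "factors_through C (?f \<cdot> h) m"
    using m h(1) f by (intro factors_through_cmp) (auto simp: image_sub_def hom_def)
  moreover have "?f \<cdot> h = pair C x z" using h k l pq lr ls by (simp add: hom_def)
  moreover have "m \<in> sub (rel_cmp C S R)" using r s pb m unfolding rel_cmp_def by auto
  ultimately show ?thesis unfolding holds_def by auto
qed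

lemma holds_cmpE:
  assumes R: "wf_rel R A B" and S: "wf_rel S B D"
    and x: "x \<in> hom C X A" and z: "z \<in> hom C X D"
    and xz: "holds (rel_cmp C S R) x z"
  obtains v y where "cover v" "Tgt C v = X" "y \<in> hom C (Src C v) B"
    "holds R (x \<cdot> v) y" "holds S y (z \<cdot> v)"
proof -
  obtain m r s p q where r: "r \<in> sub R" and s: "s \<in> sub S"
    and pb: "is_pullback C (leg2 C R r) (leg1 C S s) p q"
    and m: "m \<in> image_sub C (pair C (leg1 C R r \<cdot> p) (leg2 C S s \<cdot> q))"
    and xzm: "factors_through C (pair C x z) m"
    using xz unfolding holds_def rel_cmp_def by auto
  note lr = leg_simps(1-6)[OF R r] and ls = leg_simps(1-6)[OF S s]
  have pq: "p \<in> Arr C" "q \<in> Arr C" "Tgt C p = Src C r" "Tgt C q = Src C s" "Src C p = Src C q"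
    "leg2 C R r \<cdot> p = leg1 C S s \<cdot> q"
    using lr ls pb by (auto simp: is_pullback_def)
  let ?f = "pair C (leg1 C R r \<cdot> p) (leg2 C S s \<cdot> q)"
  have f: "?f \<in> Arr C" "Src C ?f = Src C p" "Tgt C ?f = Prod C A D"
    using pq lr ls by simp_all
  have "pair C x z \<in> Arr C" "Tgt C (pair C x z) = Tgt C ?f" "Src C (pair C x z) = X"
    using x z f by (auto simp: hom_def)
  then obtain v w where v: "cover v" "Tgt C v = X"
    and w: "w \<in> hom C (Src C v) (Src C p)" and eq: "?f \<cdot> w = pair C x z \<cdot> v"
    using image_sub_local[OF f(1) m _ _ xzm] unfolding f(2) by metis
  have "pair C (leg1 C R r \<cdot> (p \<cdot> w)) (leg2 C S s \<cdot> (q \<cdot> w)) = pair C (x \<cdot> v) (z \<cdot> v)"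
    using eq pq(1-5) lr ls w v x z by (simp add: hom_def)
  then have xv: "leg1 C R r \<cdot> (p \<cdot> w) = x \<cdot> v" and zv: "leg2 C S s \<cdot> (q \<cdot> w) = z \<cdot> v"
    using pq(1-5) lr ls w v x z by (simp_all add: hom_def pair_eq_iff)
  let ?y = "leg2 C R r \<cdot> (p \<cdot> w)"
  have y: "?y = leg1 C S s \<cdot> (q \<cdot> w)"
    using pq(1-5) w lr ls
    by (simp add: hom_def cmp_extend[OF pq(6)] cmp_extend[OF refl, of "leg1 C S s" q])
  have ty: "x \<cdot> v \<in> hom C (Src C v) A" "?y \<in> hom C (Src C v) B"
    "?y \<in> hom C (Src C v) B"
    "z \<cdot> v \<in> hom C (Src C v) D" "p \<cdot> w \<in> hom C (Src C v) (Src C r)"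
    "q \<cdot> w \<in> hom C (Src C v) (Src C s)"
    using x z v w pq(1-5) lr by (auto simp: hom_def)
  have "holds R (x \<cdot> v) ?y" unfolding holds_iff[OF R ty(1,2)] using r ty(5) xv by blast
  moreover have "holds S ?y (z \<cdot> v)" unfolding holds_iff[OF S ty(3,4)] using s ty(6) y zv by metis
  ultimately show thesis using that[OF v ty(2)] by blast
qed

text \<open>An arrow of \<open>Rel(C)\<close> is the class of one monomorphism \<open>m\<close>, and the legs of \<open>m\<close> are its
  generic pair of related elements. If they are related by another such arrow, then \<open>m\<close> factors
  through that one.\<close>

lemma rel_extensionality:
  assumes R: "R \<in> hom (Rel C) A B" and S: "S \<in> hom (Rel C) A B"
    and "\<And>X x y. x \<in> hom C X A \<Longrightarrow> y \<in> hom C X B \<Longrightarrow> holds R x y \<longleftrightarrow> holds S x y"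
  shows "R = S"
proof -
  have fac: "factors_through C m n"
    if m: "monic C m" "Tgt C m = Prod C A B" "m \<in> sub Q" and n: "monic C n" "sub Q' = sub_class C n"
      and Q: "wf_rel Q A B"
      and imp: "\<And>X x y. x \<in> hom C X A \<Longrightarrow> y \<in> hom C X B \<Longrightarrow> holds Q x y \<Longrightarrow> holds Q' x y"
    for m n Q Q'
  proof -
    note leg = leg_simps[OF Q m(3)]
    have "holds Q (leg1 C Q m) (leg2 C Q m)"
      unfolding holds_def leg(7)
      by (rule bexI[OF _ m(3)]) (rule factors_through_refl[OF monic_arr[OF m(1)]])
    then have "holds Q' (leg1 C Q m) (leg2 C Q m)"
      using imp leg(1-6) by (auto simp: hom_def)
    then show ?thesis
      unfolding holds_def leg(7) n(2) using factors_through_sub_class_iff[OF n(1)] by blast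
  qed
  obtain m where m: "monic C m" "Tgt C m = Prod C A B" "sub R = sub_class C m"
    using R by (auto simp: Rel_def hom_def subobjects_def)
  obtain n where n: "monic C n" "Tgt C n = Prod C A B" "sub S = sub_class C n"
    using S by (auto simp: Rel_def hom_def subobjects_def)
  have "factors_through C m n"
    using fac[OF m(1,2) _ n(1,3) wf_rel_Rel[OF R]] assms(3) sub_class_self[OF m(1)] m(3) by simp
  moreover have "factors_through C n m"
    using fac[OF n(1,2) _ m(1,3) wf_rel_Rel[OF S]] assms(3) sub_class_self[OF n(1)] n(3) by simp
  ultimately have "sub R = sub S"
    unfolding m(3) n(3) by (intro sub_class_eq[OF m(1) n(1)]) (simp_all add: m(2) n(2))
  then show ?thesis
    using wf_relD(5,6)[OF wf_rel_Rel[OF R]] wf_relD(5,6)[OF wf_rel_Rel[OF S]]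
    by (simp add: relation.expand)
qed

text \<open>A state relates the unique element of the terminal object to the elements that belong to
  it.\<close>

definition member :: "('o, 'a) relation \<Rightarrow> 'a \<Rightarrow> bool" where
  "member H x \<longleftrightarrow> holds H (bang (Src C x)) x"

lemma member_restrict:
  assumes "wf_rel H (One C) A" "x \<in> hom C X A" "v \<in> Arr C" "Tgt C v = X" "member H x"
  shows "member H (x \<cdot> v)"
proof -
  have "holds H (bang X \<cdot> v) (x \<cdot> v)"
    by (rule holds_restrict[OF assms(1) _ assms(2-4)])
      (use assms in \<open>auto simp: member_def hom_def\<close>)
  then show ?thesis using assms(2-4) by (simp add: member_def hom_def)
qed

lemma member_local:
  assumes "wf_rel H (One C) A" "x \<in> hom C X A" "cover v" "Tgt C v = X" "member H (x \<cdot> v)"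
  shows "member H x"
proof -
  have "holds H (bang X) x"
    by (rule holds_local[OF assms(1) _ assms(2-4)])
      (use assms in \<open>auto simp: member_def hom_def\<close>)
  then show ?thesis using assms(2) by (simp add: member_def hom_def)
qed

lemma pair_hom: "f \<in> hom C X A \<Longrightarrow> g \<in> hom C X B \<Longrightarrow> pair C f g \<in> hom C X (Prod C A B)"
  by (auto simp: hom_def)

lemma bang_hom_of: "x \<in> hom C X A \<Longrightarrow> bang X \<in> hom C X (One C)"
  using bang_hom by (auto simp: hom_def)

end

section \<open>Frobenius structures and copyable states\<close>

locale frobenius_relation = regular_cartesian_category C
  for C :: "('o, 'a, 'z) cartesian_category_scheme" (structure) +
  fixes A :: 'o and \<mu> \<eta> :: "('o, 'a) relation"
  assumes frobenius_structure: "special_dagger_frobenius (Rel C) A \<mu> \<eta>"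
begin

lemma carrier_obj [simp]: "A \<in> Obj C"
  using frobenius_structure by (simp add: special_dagger_frobenius_def)

lemma wf_mult: "wf_rel \<mu> (Prod C A A) A"
  using frobenius_structure wf_rel_Rel[of \<mu> "Prod C A A" A]
  by (simp add: special_dagger_frobenius_def)

lemma wf_unit: "wf_rel \<eta> (One C) A"
  using frobenius_structure wf_rel_Rel[of \<eta> "One C" A]
  by (simp add: special_dagger_frobenius_def)

lemma carrier_ident_hom: "Ident C A \<in> hom C A A"
  by (simp add: hom_def)

lemma wf_ident: "wf_rel (graph_rel C (Ident C A)) A A"
  by (rule wf_graph_rel[OF carrier_ident_hom])

lemma holds_ident:
  assumes "x \<in> hom C X A" "y \<in> hom C X A"
  shows "holds (graph_rel C (Ident C A)) x y \<longleftrightarrow> x = y"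
  using holds_graph[OF carrier_ident_hom assms] assms(1) by (simp add: hom_def)

lemma left_unit:
  "rel_cmp C \<mu> (rel_tensor C \<eta> (graph_rel C (Ident C A))) = graph_rel C (Proj2 C (One C) A)"
  using frobenius_structure by (simp add: special_dagger_frobenius_def)

lemma frobenius:
  "rel_cmp C
     (rel_cmp C (rel_tensor C \<mu> (graph_rel C (Ident C A)))
       (rel_dagger C (graph_rel C (product_assoc C A A A))))
     (rel_tensor C (graph_rel C (Ident C A)) (rel_dagger C \<mu>)) =
   rel_cmp C
     (rel_cmp C (rel_tensor C (graph_rel C (Ident C A)) \<mu>) (graph_rel C (product_assoc C A A A)))
     (rel_tensor C (rel_dagger C \<mu>) (graph_rel C (Ident C A)))"
  using frobenius_structure by (simp add: special_dagger_frobenius_def)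

definition times :: "'a \<Rightarrow> 'a \<Rightarrow> 'a \<Rightarrow> bool" where
  "times x y z \<longleftrightarrow> holds \<mu> (pair C x y) z"

lemma times_restrict:
  assumes "x \<in> hom C X A" "y \<in> hom C X A" "z \<in> hom C X A" "v \<in> Arr C" "Tgt C v = X" "times x y z"
  shows "times (x \<cdot> v) (y \<cdot> v) (z \<cdot> v)"
proof -
  have "holds \<mu> (pair C x y \<cdot> v) (z \<cdot> v)"
    by (rule holds_restrict[OF wf_mult pair_hom[OF assms(1,2)] assms(3-5)])
      (use assms(6) in \<open>simp add: times_def\<close>)
  then show ?thesis using assms(1-5) by (simp add: times_def hom_def)
qed

lemma proj_unit_hom: "Proj2 C (One C) A \<in> hom C (Prod C (One C) A) A"
  by (simp add: hom_def)

text \<open>The two inclusions in the left unit law: every element has a left unit, and multiplying by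
  a unit changes nothing.\<close>

lemma left_unit_exists:
  assumes a: "a \<in> hom C X A"
  obtains v e where "cover v" "Tgt C v = X" "e \<in> hom C (Src C v) A" "member \<eta> e"
    "times e (a \<cdot> v) (a \<cdot> v)"
proof -
  note bang = bang_hom_of[OF a]
  have "holds (graph_rel C (Proj2 C (One C) A)) (pair C (bang X) a) a"
    using holds_graph[OF proj_unit_hom pair_hom[OF bang a] a] bang a by (simp add: hom_def)
  then obtain v y where v: "cover v" "Tgt C v = X" and y: "y \<in> hom C (Src C v) (Prod C A A)"
    and 1: "holds (rel_tensor C \<eta> (graph_rel C (Ident C A))) (pair C (bang X) a \<cdot> v) y"
    and 2: "holds \<mu> y (a \<cdot> v)"
    unfolding left_unit[symmetric]
    by (rule holds_cmpE[OF wf_rel_tensor[OF wf_unit wf_ident] wf_mult pair_hom[OF bang a] a])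
  obtain e b where e: "e \<in> hom C (Src C v) A" and b: "b \<in> hom C (Src C v) A" and yp: "y = pair C e b"
    using pair_cases[OF carrier_obj carrier_obj y] .
  have ty: "bang (Src C v) \<in> hom C (Src C v) (One C)" "a \<cdot> v \<in> hom C (Src C v) A"
    "pair C (bang X) a \<cdot> v = pair C (bang (Src C v)) (a \<cdot> v)"
    using a v bang by (auto simp: hom_def)
  have "holds \<eta> (bang (Src C v)) e \<and> a \<cdot> v = b"
    using 1 unfolding yp ty(3) holds_tensor[OF wf_unit wf_ident ty(1,2) e b] holds_ident[OF ty(2) b] .
  then show thesis
    using that[OF v e] 2 e unfolding yp by (auto simp: member_def times_def hom_def)
qed

lemma left_unit_unique:
  assumes e: "e \<in> hom C X A" and x: "x \<in> hom C X A" and y: "y \<in> hom C X A"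
    and "member \<eta> e" "times e x y"
  shows "x = y"
proof -
  note bang = bang_hom_of[OF x]
  have "holds (rel_tensor C \<eta> (graph_rel C (Ident C A))) (pair C (bang X) x) (pair C e x)"
    unfolding holds_tensor[OF wf_unit wf_ident bang x e x] holds_ident[OF x x]
    using assms(4) e by (simp add: member_def hom_def)
  then have "holds (rel_cmp C \<mu> (rel_tensor C \<eta> (graph_rel C (Ident C A)))) (pair C (bang X) x) y"
    using assms(5) unfolding times_def
    by (rule holds_cmpI[OF wf_rel_tensor[OF wf_unit wf_ident] wf_mult
          pair_hom[OF bang x] pair_hom[OF e x] y])
  then have "Proj2 C (One C) A \<cdot> pair C (bang X) x = y"
    unfolding left_unit holds_graph[OF proj_unit_hom pair_hom[OF bang x] y] .
  then show ?thesis using x bang by (simp add: hom_def)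
qed

lemma product_assoc_hom:
  "product_assoc C A A A \<in> hom C (Prod C (Prod C A A) A) (Prod C A (Prod C A A))"
  by (simp add: product_assoc_def hom_def)

lemma product_assoc_pair:
  assumes "x \<in> hom C X A" "y \<in> hom C X A" "z \<in> hom C X A"
  shows "product_assoc C A A A \<cdot> pair C (pair C x y) z = pair C x (pair C y z)"
  using assms by (simp add: product_assoc_def hom_def)

text \<open>The Frobenius law on elements. Each side of it relates \<open>(a, b)\<close> to \<open>(c, d)\<close>. The first
  does so if \<open>b\<close> is a product of some \<open>x\<close> and \<open>d\<close> such that \<open>c\<close> is a product of \<open>a\<close> and
  \<open>x\<close>. For the second, \<open>a\<close> is a product of \<open>c\<close> and some \<open>y\<close> such that \<open>d\<close> is a product
  of \<open>y\<close> and \<open>b\<close>.\<close>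

lemma times_exchange:
  assumes a: "a \<in> hom C X A" and b: "b \<in> hom C X A" and c: "c \<in> hom C X A" and d: "d \<in> hom C X A"
    and x: "x \<in> hom C X A" and xd: "times x d b" and ax: "times a x c"
  obtains v y where "cover v" "Tgt C v = X" "y \<in> hom C (Src C v) A"
    "times (c \<cdot> v) y (a \<cdot> v)" "times y (b \<cdot> v) (d \<cdot> v)"
proof -
  let ?i = "graph_rel C (Ident C A)" and ?\<alpha> = "graph_rel C (product_assoc C A A A)"
  note wf_assoc = wf_graph_rel[OF product_assoc_hom]
  note wf_comult = wf_rel_dagger[OF wf_mult]
  note ax_d = pair_hom[OF pair_hom[OF a x] d] and a_xd = pair_hom[OF a pair_hom[OF x d]]
  have "holds (rel_tensor C ?i (rel_dagger C \<mu>)) (pair C a b) (pair C a (pair C x d))"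
    unfolding holds_tensor[OF wf_ident wf_comult a b a pair_hom[OF x d]] holds_ident[OF a a]
      holds_dagger[OF wf_mult pair_hom[OF x d] b]
    using xd by (simp add: times_def)
  moreover have "holds (rel_dagger C ?\<alpha>) (pair C a (pair C x d)) (pair C (pair C a x) d)"
    unfolding holds_dagger[OF wf_assoc ax_d a_xd] holds_graph[OF product_assoc_hom ax_d a_xd]
    by (rule product_assoc_pair[OF a x d])
  moreover have "holds (rel_tensor C \<mu> ?i) (pair C (pair C a x) d) (pair C c d)"
    unfolding holds_tensor[OF wf_mult wf_ident pair_hom[OF a x] d c d] holds_ident[OF d d]
    using ax by (simp add: times_def)
  ultimately have "holds (rel_cmp C (rel_cmp C (rel_tensor C \<mu> ?i) (rel_dagger C ?\<alpha>))
      (rel_tensor C ?i (rel_dagger C \<mu>))) (pair C a b) (pair C c d)"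
    using holds_cmpI[OF wf_rel_dagger[OF wf_assoc] wf_rel_tensor[OF wf_mult wf_ident]
        a_xd ax_d pair_hom[OF c d]]
      holds_cmpI[OF wf_rel_tensor[OF wf_ident wf_comult]
        wf_rel_cmp[OF wf_rel_dagger[OF wf_assoc] wf_rel_tensor[OF wf_mult wf_ident]]
        pair_hom[OF a b] a_xd pair_hom[OF c d]]
    by blast
  then obtain v u where v: "cover v" "Tgt C v = X"
    and u: "u \<in> hom C (Src C v) (Prod C (Prod C A A) A)"
    and 1: "holds (rel_tensor C (rel_dagger C \<mu>) ?i) (pair C a b \<cdot> v) u"
    and 2: "holds (rel_cmp C (rel_tensor C ?i \<mu>) ?\<alpha>) u (pair C c d \<cdot> v)"
    unfolding frobenius
    by (rule holds_cmpE[OF wf_rel_tensor[OF wf_comult wf_ident]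
          wf_rel_cmp[OF wf_assoc wf_rel_tensor[OF wf_ident wf_mult]]
          pair_hom[OF a b] pair_hom[OF c d]])
  have cdv: "pair C c d \<cdot> v \<in> hom C (Src C v) (Prod C A A)"
    using pair_hom[OF c d] v by (auto simp: hom_def)
  obtain w t where w: "cover w" "Tgt C w = Src C v"
    and t: "t \<in> hom C (Src C w) (Prod C A (Prod C A A))"
    and 3: "holds ?\<alpha> (u \<cdot> w) t"
    and 4: "holds (rel_tensor C ?i \<mu>) t (pair C c d \<cdot> v \<cdot> w)"
    using 2 by (rule holds_cmpE[OF wf_assoc wf_rel_tensor[OF wf_ident wf_mult] u cdv])
  \<comment> \<open>\<open>u\<close> exists on the cover \<open>v\<close>, and its reassociation \<open>t\<close> on the further cover \<open>w\<close>\<close>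
  let ?vw = "v \<cdot> w"
  have vw: "cover ?vw" "Tgt C ?vw = X" "Src C ?vw = Src C w"
    using v w cover_cmp by simp_all
  have restrict: "z \<cdot> ?vw \<in> hom C (Src C w) A" if "z \<in> hom C X A" for z
    using that v w by (auto simp: hom_def)
  note ty = restrict[OF a] restrict[OF b] restrict[OF c] restrict[OF d]
  have uw: "u \<cdot> w \<in> hom C (Src C w) (Prod C (Prod C A A) A)"
    using u w by (auto simp: hom_def)
  obtain g h where g: "g \<in> hom C (Src C w) (Prod C A A)" and h: "h \<in> hom C (Src C w) A"
    and uw_gh: "u \<cdot> w = pair C g h"
    using pair_cases[OF prod_obj[OF carrier_obj carrier_obj] carrier_obj uw] .
  obtain k y where k: "k \<in> hom C (Src C w) A" and y: "y \<in> hom C (Src C w) A" and gk: "g = pair C k y"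
    using pair_cases[OF carrier_obj carrier_obj g] .
  have abv: "pair C a b \<cdot> v \<in> hom C (Src C v) (Prod C A A)"
    using pair_hom[OF a b] v by (auto simp: hom_def)
  have "holds (rel_tensor C (rel_dagger C \<mu>) ?i) (pair C a b \<cdot> v \<cdot> w) (u \<cdot> w)"
    by (rule holds_restrict[OF wf_rel_tensor[OF wf_comult wf_ident] abv u _ _ 1]) (use w in simp_all)
  moreover have "pair C a b \<cdot> v \<cdot> w = pair C (a \<cdot> ?vw) (b \<cdot> ?vw)"
    "pair C c d \<cdot> v \<cdot> w = pair C (c \<cdot> ?vw) (d \<cdot> ?vw)"
    using a b c d v w by (simp_all add: hom_def)
  moreover have "t = pair C k (pair C y h)"
    using 3 product_assoc_pair[OF k y h]
    unfolding uw_gh gk holds_graph[OF product_assoc_hom uw[unfolded uw_gh gk] t] by simp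
  ultimately have
    "holds (rel_tensor C (rel_dagger C \<mu>) ?i) (pair C (a \<cdot> ?vw) (b \<cdot> ?vw)) (pair C (pair C k y) h)"
    "holds (rel_tensor C ?i \<mu>) (pair C k (pair C y h)) (pair C (c \<cdot> ?vw) (d \<cdot> ?vw))"
    using 4 uw_gh gk by simp_all
  then have "times k y (a \<cdot> ?vw)" "b \<cdot> ?vw = h" "k = c \<cdot> ?vw" "times y h (d \<cdot> ?vw)"
    unfolding holds_tensor[OF wf_comult wf_ident ty(1,2) pair_hom[OF k y] h]
      holds_tensor[OF wf_ident wf_mult k pair_hom[OF y h] ty(3,4)]
      holds_ident[OF ty(2) h] holds_ident[OF k ty(3)]
      holds_dagger[OF wf_mult pair_hom[OF k y] ty(1)]
    by (simp_all add: times_def)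
  then show thesis using that[OF vw(1,2)] y vw(3) by simp
qed

lemma wf_copyable:
  "copyable_state (Rel C) A \<mu> H \<Longrightarrow> wf_rel H (One C) A"
  using wf_rel_Rel[of H "One C" A] by (simp add: copyable_state_def)

lemma copyable:
  "copyable_state (Rel C) A \<mu> H \<Longrightarrow>
    rel_cmp C (rel_cmp C (rel_dagger C \<mu>) H) (graph_rel C (Proj2 C (One C) (One C))) =
    rel_tensor C H H"
  by (simp add: copyable_state_def)

lemma proj_one_hom: "Proj2 C (One C) (One C) \<in> hom C (Prod C (One C) (One C)) (One C)"
  by (simp add: hom_def)

text \<open>The two inclusions in the equation of a copyable state: two members have a product that is a
  member, and the factors of a member are members.\<close>

lemma copyable_times_exists:
  assumes H: "copyable_state (Rel C) A \<mu> H" and x: "x \<in> hom C X A" and y: "y \<in> hom C X A"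
    and mem: "member H x" "member H y"
  obtains v z where "cover v" "Tgt C v = X" "z \<in> hom C (Src C v) A" "member H z"
    "times (x \<cdot> v) (y \<cdot> v) z"
proof -
  note wf = wf_copyable[OF H] and bang = bang_hom_of[OF x]
  note wf_comult = wf_rel_dagger[OF wf_mult]
  have "holds (rel_tensor C H H) (pair C (bang X) (bang X)) (pair C x y)"
    unfolding holds_tensor[OF wf wf bang bang x y]
    using mem x y by (simp add: member_def hom_def)
  then obtain v t where v: "cover v" "Tgt C v = X" and t: "t \<in> hom C (Src C v) (One C)"
    and 1: "holds (rel_cmp C (rel_dagger C \<mu>) H) t (pair C x y \<cdot> v)"
    unfolding copyable[OF H, symmetric]
    by (rule holds_cmpE[OF wf_graph_rel[OF proj_one_hom] wf_rel_cmp[OF wf wf_comult]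
          pair_hom[OF bang bang] pair_hom[OF x y]])
  have xyv: "pair C x y \<cdot> v \<in> hom C (Src C v) (Prod C A A)"
    using pair_hom[OF x y] v by (auto simp: hom_def)
  obtain w z where w: "cover w" "Tgt C w = Src C v" and z: "z \<in> hom C (Src C w) A"
    and 2: "holds H (t \<cdot> w) z" and 3: "holds (rel_dagger C \<mu>) z (pair C x y \<cdot> v \<cdot> w)"
    using 1 by (rule holds_cmpE[OF wf wf_comult t xyv])
  have "t \<cdot> w = bang (Src C z)"
    using bang_unique[of "t \<cdot> w"] t w z by (simp add: hom_def)
  then have "member H z" using 2 by (simp add: member_def)
  moreover have "holds \<mu> (pair C x y \<cdot> v \<cdot> w) z"
    using 3 holds_dagger[OF wf_mult _ z, of "pair C x y \<cdot> v \<cdot> w"] xyv w by (simp add: hom_def)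
  then have "times (x \<cdot> (v \<cdot> w)) (y \<cdot> (v \<cdot> w)) z"
    using x y v w by (simp add: times_def hom_def)
  ultimately show thesis using that[of "v \<cdot> w" z] v w z cover_cmp by simp
qed

lemma copyable_factors:
  assumes H: "copyable_state (Rel C) A \<mu> H" and x: "x \<in> hom C X A" and y: "y \<in> hom C X A"
    and z: "z \<in> hom C X A" and "times x y z" "member H z"
  shows "member H x" "member H y"
proof -
  note wf = wf_copyable[OF H] and bang = bang_hom_of[OF x]
  note wf_comult = wf_rel_dagger[OF wf_mult]
  have "holds H (bang X) z" using assms(6) z by (simp add: member_def hom_def)
  moreover have "holds (rel_dagger C \<mu>) z (pair C x y)"
    unfolding holds_dagger[OF wf_mult pair_hom[OF x y] z] using assms(5) by (simp add: times_def)
  moreover have "holds (graph_rel C (Proj2 C (One C) (One C))) (pair C (bang X) (bang X)) (bang X)"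
    unfolding holds_graph[OF proj_one_hom pair_hom[OF bang bang] bang]
    using bang by (simp add: hom_def)
  ultimately have "holds (rel_tensor C H H) (pair C (bang X) (bang X)) (pair C x y)"
    unfolding copyable[OF H, symmetric]
    using holds_cmpI[OF wf wf_comult bang z pair_hom[OF x y]]
      holds_cmpI[OF wf_graph_rel[OF proj_one_hom] wf_rel_cmp[OF wf wf_comult]
        pair_hom[OF bang bang] bang pair_hom[OF x y]] by blast
  then show "member H x" "member H y"
    unfolding holds_tensor[OF wf wf bang bang x y]
    using x y by (simp_all add: member_def hom_def)
qed

text \<open>The argument with a unit \<open>e\<close> of \<open>a\<close> described at the beginning. Each element that is
  found lives on a cover: the unit \<open>e\<close> on \<open>u\<close>, the product of \<open>e\<close> and \<open>x\<close> on \<open>v\<close>, the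
  square of \<open>a\<close> on \<open>w\<close>, and the right inverse \<open>y\<close> on \<open>t\<close>. Since membership is local, each
  cover is discarded once its element has served.\<close>

lemma member_of_common_member:
  assumes H: "copyable_state (Rel C) A \<mu> H" and T: "copyable_state (Rel C) A \<mu> T"
    and a: "a \<in> hom C X A" "member H a" and x: "x \<in> hom C X A" "member H x" "member T x"
  shows "member T a"
proof -
  note wfH = wf_copyable[OF H] and wfT = wf_copyable[OF T]
  have res: "z \<cdot> v \<in> hom C (Src C v) A" if "z \<in> hom C Y A" "cover v" "Tgt C v = Y" for z v Y
    using that by (auto simp: hom_def)
  obtain u e where u: "cover u" "Tgt C u = X" and e: "e \<in> hom C (Src C u) A" "member \<eta> e"
    and ea: "times e (a \<cdot> u) (a \<cdot> u)"
    using left_unit_exists[OF a(1)] .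
  define a1 x1 where "a1 = a \<cdot> u" and "x1 = x \<cdot> u"
  have a1: "a1 \<in> hom C (Src C u) A" "member H a1"
    and x1: "x1 \<in> hom C (Src C u) A" "member H x1" "member T x1"
    unfolding a1_def x1_def
    using res[OF _ u] a x u member_restrict[OF wfH] member_restrict[OF wfT] by auto
  have eH: "member H e"
    using copyable_factors(1)[OF H e(1) a1(1) a1(1) _ a1(2)] ea unfolding a1_def by blast
  obtain v z where v: "cover v" "Tgt C v = Src C u" and z: "z \<in> hom C (Src C v) A"
    and exz: "times (e \<cdot> v) (x1 \<cdot> v) z"
    using copyable_times_exists[OF H e(1) x1(1) eH x1(2)] by metis
  have "member \<eta> (e \<cdot> v)" using member_restrict[OF wf_unit e(1) _ v(2) e(2)] v by simp
  then have "x1 \<cdot> v = z"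
    using left_unit_unique[OF res[OF e(1) v] res[OF x1(1) v] z _ exz] by blast
  then have "member T z" using member_restrict[OF wfT x1(1) _ v(2) x1(3)] v by auto
  then have "member T (e \<cdot> v)"
    using copyable_factors(1)[OF T res[OF e(1) v] res[OF x1(1) v] z exz] by blast
  then have eT: "member T e" by (rule member_local[OF wfT e(1) v])
  \<comment> \<open>the square of \<open>a\<close> is needed only as input to the Frobenius law\<close>
  obtain w b where w: "cover w" "Tgt C w = Src C u" and b: "b \<in> hom C (Src C w) A"
    and aab: "times (a1 \<cdot> w) (a1 \<cdot> w) b"
    using copyable_times_exists[OF H a1(1) a1(1) a1(2) a1(2)] by metis
  have "times (e \<cdot> w) (a1 \<cdot> w) (a1 \<cdot> w)"
    using times_restrict[OF e(1) a1(1) a1(1) _ w(2)] ea w unfolding a1_def by simp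
  then obtain t y where t: "cover t" "Tgt C t = Src C w" and y: "y \<in> hom C (Src C t) A"
    and aye: "times (a1 \<cdot> w \<cdot> t) y (e \<cdot> w \<cdot> t)"
    by (rule times_exchange[OF res[OF e(1) w] b res[OF a1(1) w] res[OF a1(1) w] res[OF a1(1) w] aab])
  have "member T (e \<cdot> w)" using member_restrict[OF wfT e(1) _ w(2) eT] w by simp
  then have "member T (e \<cdot> w \<cdot> t)" using member_restrict[OF wfT res[OF e(1) w] _ t(2)] t by simp
  then have "member T (a1 \<cdot> w \<cdot> t)"
    using copyable_factors(1)[OF T res[OF res[OF a1(1) w] t] y res[OF res[OF e(1) w] t] aye] by blast
  then have "member T (a1 \<cdot> w)" by (rule member_local[OF wfT res[OF a1(1) w] t])
  then have "member T a1" by (rule member_local[OF wfT a1(1) w])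
  then show ?thesis unfolding a1_def by (rule member_local[OF wfT a(1) u])
qed

end

section \<open>Uniqueness of copyable states\<close>

context regular_cartesian_category
begin

text \<open>The unique arrow from \<open>X\<close> to the terminal object factors through the image of \<open>U\<close>, which
  is everything; so on a cover it lifts to \<open>U\<close>.\<close>

lemma inhabited_cover:
  assumes "inhabited C U" "U \<in> Obj C" "X \<in> Obj C"
  obtains v w where "cover v" "Tgt C v = X" "w \<in> hom C (Src C v) U"
proof -
  have "image_sub C (bang U) = sub_class C (Ident C (One C))"
    using assms(1,2) bang_hom finite_products unfolding inhabited_def chosen_finite_products_def by blast
  moreover have "monic C (Ident C (One C))" unfolding monic_def by (auto simp: hom_def)
  ultimately have "Ident C (One C) \<in> image_sub C (bang U)" using sub_class_self by simp
  moreover have "factors_through C (bang X) (Ident C (One C))"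
    using assms(3) by (intro factors_throughI[of "bang X"]) simp_all
  ultimately show thesis
    using image_sub_local[of "bang U" "Ident C (One C)" "bang X"] that assms(2,3) by auto
qed

text \<open>Subobjects of the product of the terminal object and \<open>A\<close> are subobjects of \<open>A\<close> via the
  second leg. The common element is the generic one, defined on the pullback that represents the
  intersection.\<close>

lemma common_member:
  assumes H: "wf_rel H (One C) A" "sub H \<noteq> {}" and T: "wf_rel T (One C) A" "sub T \<noteq> {}"
  obtains U x where "x \<in> hom C U A" "member H x" "member T x"
proof -
  obtain h t where h: "h \<in> sub H" and t: "t \<in> sub T" using H T by blast
  note lh = leg_simps(1-6)[OF H(1) h] and lt = leg_simps(1-6)[OF T(1) t]
  obtain p q where "is_pullback C (leg2 C H h) (leg2 C T t) p q"
    using pullback_exists[of "leg2 C H h" "leg2 C T t"] lh lt by auto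
  then have p: "p \<in> Arr C" "Tgt C p = Src C h" and q: "q \<in> Arr C" "Tgt C q = Src C t"
    and pq: "Src C q = Src C p" "leg2 C H h \<cdot> p = leg2 C T t \<cdot> q"
    using lh lt by (auto simp: is_pullback_def)
  have x: "leg2 C H h \<cdot> p \<in> hom C (Src C p) A" using lh p by (simp add: hom_def)
  note bang = bang_hom_of[OF x]
  have "leg1 C H h \<cdot> p = bang (Src C p)" "leg1 C T t \<cdot> q = bang (Src C p)"
    using bang_unique[of "leg1 C H h \<cdot> p"] bang_unique[of "leg1 C T t \<cdot> q"] lh lt p q pq(1) by simp_all
  moreover have "p \<in> hom C (Src C p) (Src C h)" "q \<in> hom C (Src C p) (Src C t)"
    using p q pq(1) by (simp_all add: hom_def)
  ultimately have "holds H (bang (Src C p)) (leg2 C H h \<cdot> p)" "holds T (bang (Src C p)) (leg2 C H h \<cdot> p)"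
    unfolding holds_iff[OF H(1) bang x] holds_iff[OF T(1) bang x] using h t pq(2) by metis+
  then show thesis using that[OF x] x by (simp add: member_def hom_def)
qed

lemma state_eqI:
  assumes H: "H \<in> hom (Rel C) (One C) A" and T: "T \<in> hom (Rel C) (One C) A"
    and "\<And>X x. x \<in> hom C X A \<Longrightarrow> member H x \<longleftrightarrow> member T x"
  shows "H = T"
proof (rule rel_extensionality[OF H T])
  fix X u x
  assume u: "u \<in> hom C X (One C)" and x: "x \<in> hom C X A"
  have "u = bang (Src C x)" using bang_unique[of u] u x by (simp add: hom_def)
  then show "holds H u x \<longleftrightarrow> holds T u x" using assms(3)[OF x] by (simp add: member_def)
qed

lemma sub_nonempty:
  assumes "R \<in> hom (Rel C) A B"
  shows "sub R \<noteq> {}"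
proof -
  obtain m where "monic C m" "sub R = sub_class C m"
    using assms by (auto simp: Rel_def hom_def subobjects_def)
  then show ?thesis using sub_class_self by blast
qed

end

context frobenius_relation
begin

text \<open>Since the intersection \<open>U\<close> of the two states is inhabited, \<open>a\<close> and the generic common
  element \<open>x\<close> can be restricted to a common domain.\<close>

lemma copyable_member_mono:
  assumes "entirely_inhabited C"
    and H: "copyable_state (Rel C) A \<mu> H" and T: "copyable_state (Rel C) A \<mu> T"
    and a: "a \<in> hom C X A" "member H a"
  shows "member T a"
proof -
  note wfH = wf_copyable[OF H] and wfT = wf_copyable[OF T]
  have "sub H \<noteq> {}" "sub T \<noteq> {}"
    using sub_nonempty H T by (auto simp: copyable_state_def)
  then obtain U x where x: "x \<in> hom C U A" "member H x" "member T x"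
    using common_member[OF wfH _ wfT] by blast
  have U: "U \<in> Obj C" and X: "X \<in> Obj C" using x a by (auto simp: hom_def)
  have "inhabited C U" using assms(1) U by (simp add: entirely_inhabited_def)
  then obtain v w where v: "cover v" "Tgt C v = X" and w: "w \<in> hom C (Src C v) U"
    using inhabited_cover U X by blast
  have w': "w \<in> Arr C" "Tgt C w = U" using w by (auto simp: hom_def)
  have "a \<cdot> v \<in> hom C (Src C v) A" "x \<cdot> w \<in> hom C (Src C v) A"
    using a x v w by (auto simp: hom_def)
  moreover have "member H (a \<cdot> v)" "member H (x \<cdot> w)" "member T (x \<cdot> w)"
    using member_restrict[OF wfH a(1) _ v(2) a(2)] member_restrict[OF wfH x(1) w' x(2)]
      member_restrict[OF wfT x(1) w' x(3)] v by auto
  ultimately have "member T (a \<cdot> v)" using member_of_common_member[OF H T] by blast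
  then show ?thesis by (rule member_local[OF wfT a(1) v])
qed

end

theorem proposition5p10:
  fixes C :: "('o, 'a) cartesian_category"
    and A :: 'o
    and \<mu> \<eta> H T :: "('o, 'a) relation"
  assumes "regular_category C"
    and "chosen_finite_products C"
    and "entirely_inhabited C"
    and "special_dagger_frobenius (Rel C) A \<mu> \<eta>"
    and "copyable_state (Rel C) A \<mu> H"
    and "copyable_state (Rel C) A \<mu> T"
  shows "H = T"
proof -
  interpret regular_category C by (rule assms(1))
  interpret frobenius_relation C A \<mu> \<eta>
    by unfold_locales (rule assms(2,4))+
  show ?thesis
  proof (rule state_eqI)
    show "H \<in> hom (Rel C) (One C) A" "T \<in> hom (Rel C) (One C) A"
      using assms(5,6) by (simp_all add: copyable_state_def)
    show "member H x \<longleftrightarrow> member T x" if "x \<in> hom C X A" for X x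
      using copyable_member_mono[OF assms(3,5,6) that] copyable_member_mono[OF assms(3,6,5) that]
      by blast
  qed
qed

end
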